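(* Let $0<T_{\min}\le T_{\max}<\infty$. Consider the timer-dependent impulsive system $$\partial_\tau x(t_k+\tau)=A(\tau)x(t_k+\tau)+B_c(\tau)u_c(t_k+\tau)+E_c(\tau)w_c(t_k+\tau),\ \tau\in(0,T_k],\ k\ge0;$$ $$x(t_k^+)=Jx(t_k)+B_du_d(k)+E_dw_d(k),\ k\ge1;\qquad z_d(k)=C_dx(t_k)+D_du_d(k)+F_dw_d(k),\ k\ge1;$$ $$z_c(t_k+\tau)=C_c(\tau)x(t_k+\tau)+D_c(\tau)u_c(t_k+\tau)+F_c(\tau)w_c(t_k+\tau),\ \tau\in(0,T_k],\ k\ge0;\qquad x(0)=x(0^+)=x_0\in\mathbb{R}^n,$$ with $E_c(\tau),F_c(\tau),E_d,F_d$ nonnegative, and the control law $u_c(t_k+\tau)=K_c(\tau)x(t_k+\tau)$, $\tau\in(0,T_k]$, $u_d(k)=K_d(T_{k-1})x(t_k)$, where $K_c:[0,T_{\max}]\to\mathbb{R}^{m_c\times n}$ and $K_d:[T_{\min},T_{\max}]\to\mathbb{R}^{m_d\times n}$. Assume that there exist a differentiable matrix-valued function $X:[0,T_{\max}]\to\mathbb{D}^n$, $X(0)\succ0$, matrix-valued functions $U_c:[0,T_{\max}]\to\mathbb{R}^{m_c\times n}$, $U_d:[T_{\min},T_{\max}]\to\mathbb{R}^{m_d\times n}$ and scalars $\varepsilon,\alpha,\gamma>0$ such that $$\begin{array}{rl} A(\tau)X(\tau)+B_c(\tau)U_c(\tau)+\alpha I_n&\ge0,\\ JX(\theta)+B_dU_d(\theta)&\ge0,\\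 C_c(\tau)X(\tau)+D_c(\tau)U_c(\tau)&\ge0,\\ C_dX(\theta)+D_dU_d(\theta)&\ge0 \end{array}$$ and $$\begin{array}{rl} [-\dot X(\tau)+A(\tau)X(\tau)+B_c(\tau)U_c(\tau)]\mathbf 1+E_c(\tau)\mathbf 1&\le0,\\ {}[JX(\theta)+B_dU_d(\theta)-X(0)+\varepsilon I]\mathbf 1+E_d\mathbf 1&\le0,\\ {}[C_c(\tau)X(\tau)+D_c(\tau)U_c(\tau)]\mathbf 1+F_c(\tau)\mathbf 1-\gamma\mathbf 1&\le0,\\ {}[C_dX(\theta)+D_dU_d(\theta)]\mathbf 1+F_d\mathbf 1-\gamma\mathbf 1&\le0 \end{array}$$ hold for all $\tau\in[0,T_{\max}]$ and all $\theta\in[T_{\min},T_{\max}]$. Then, under range dwell-time $[T_{\min},T_{\max}]$, the closed-loop system is asymptotically stable and has hybrid $L_\infty\times\ell_\infty$-gain less than $\gamma$ with the controller gains $K_c(\tau)=U_c(\tau)X(\tau)^{-1}$ and $K_d(\theta)=U_d(\theta)X(\theta)^{-1}$.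
   Context: Matrix and vector inequalities $\ge,\le$ are componentwise; $\mathbf 1$ is the all-ones vector; $f(t^+)=\lim_{s\downarrow t}f(s)$; $\mathbb{D}^n$ is the set of $n\times n$ diagonal matrices and $\succ0$ means positive definite. The functions of the timer $\tau$ (time since the last impulse) are continuous and bounded; $T_k=t_{k+1}-t_k$. Range dwell-time $[T_{\min},T_{\max}]$: all impulse sequences with $t_0=0$ and $t_{k+1}-t_k\in[T_{\min},T_{\max}]$, $k\ge0$, are considered. Stability refers to $w_c,w_d\equiv0$. The hybrid $L_\infty\times\ell_\infty$-gain is the supremum of $\max\{\|z_c\|_{L_\infty},\|z_d\|_{\ell_\infty}\}$ over inputs with $\max\{\|w_c\|_{L_\infty},\|w_d\|_{\ell_\infty}\}=1$, $x_0=0$, and over all these sequences (vector $\infty$-norm pointwise).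
   Formalization: The gain is shown to be at most γ, since "less than γ" fails (all coefficients zero except F_c=γ gives gain exactly γ); X(τ) is assumed invertible on [0,T_max], as the gain formulas need; U_c is taken continuous like the other timer functions. *)

theory Defs
  imports "HOL-Probability.Essential_Supremum"
begin

text \<open>
  Coefficients of the impulsive system. Flow coefficients are functions of the timer, jump
  coefficients are constant. Index types: \<open>'n\<close> state, \<open>'mc\<close>/\<open>'md\<close> control inputs,
  \<open>'pc\<close>/\<open>'pd\<close> exogenous inputs, \<open>'qc\<close>/\<open>'qd\<close> performance outputs (continuous/discrete).
\<close>

record ('n, 'mc, 'md, 'pc, 'pd, 'qc, 'qd) impulsive_system =
  sysA  :: "real \<Rightarrow> real^'n^'n"
  sysBc :: "real \<Rightarrow> real^'mc^'n"
  sysEc :: "real \<Rightarrow> real^'pc^'n"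
  sysCc :: "real \<Rightarrow> real^'n^'qc"
  sysDc :: "real \<Rightarrow> real^'mc^'qc"
  sysFc :: "real \<Rightarrow> real^'pc^'qc"
  sysJ  :: "real^'n^'n"
  sysBd :: "real^'md^'n"
  sysEd :: "real^'pd^'n"
  sysCd :: "real^'n^'qd"
  sysDd :: "real^'md^'qd"
  sysFd :: "real^'pd^'qd"

definition diagonal_matrix :: "real^'n^'n \<Rightarrow> bool" where
  "diagonal_matrix M \<longleftrightarrow> (\<forall>i j. i \<noteq> j \<longrightarrow> M $ i $ j = 0)"

definition positive_definite :: "real^'n^'n \<Rightarrow> bool" where
  "positive_definite M \<longleftrightarrow> transpose M = M \<and> (\<forall>v. v \<noteq> 0 \<longrightarrow> 0 < v \<bullet> (M *v v))"

definition range_dwell_time :: "real \<Rightarrow> real \<Rightarrow> (nat \<Rightarrow> real) set" where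
  "range_dwell_time Tmin Tmax =
     {t. t 0 = 0 \<and> (\<forall>k. t (Suc k) - t k \<in> {Tmin..Tmax})}"

text \<open>
  Since \<open>w\<^sub>c\<close> is only an \<open>L\<^sub>\<infinity>\<close> signal, the flow equation is read in the sense of
  Caratheodory, i.e. as an integral equation on the compact subintervals of \<open>(0, T\<^sub>k]\<close>.
  The state is left-continuous at the impulse times: \<open>x (t k)\<close> is the value before the jump,
  and the value after the jump is the right limit. The discrete signals \<open>ud\<close>, \<open>wd\<close>, \<open>zd\<close> are
  used at indices \<open>k \<ge> 1\<close> only, and \<open>uc\<close>, \<open>zc\<close> at times \<open>t > 0\<close> only (up to null sets).
\<close>

definition trajectory ::
  "('n::finite, 'mc::finite, 'md::finite, 'pc::finite, 'pd::finite, 'qc::finite, 'qd::finite)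
     impulsive_system \<Rightarrow> (nat \<Rightarrow> real) \<Rightarrow> real^'n \<Rightarrow>
   (real \<Rightarrow> real^'mc) \<Rightarrow> (nat \<Rightarrow> real^'md) \<Rightarrow> (real \<Rightarrow> real^'pc) \<Rightarrow> (nat \<Rightarrow> real^'pd) \<Rightarrow>
   (real \<Rightarrow> real^'n) \<Rightarrow> (real \<Rightarrow> real^'qc) \<Rightarrow> (nat \<Rightarrow> real^'qd) \<Rightarrow> bool"
where
  "trajectory S t x0 uc ud wc wd x zc zd \<longleftrightarrow>
     x 0 = x0 \<and> (x \<longlongrightarrow> x0) (at_right 0) \<and>
     (\<forall>k \<sigma> \<tau>. 0 < \<sigma> \<and> \<sigma> \<le> \<tau> \<and> \<tau> \<le> t (Suc k) - t k \<longrightarrow>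
        ((\<lambda>s. sysA S s *v x (t k + s) + sysBc S s *v uc (t k + s) + sysEc S s *v wc (t k + s))
          has_integral (x (t k + \<tau>) - x (t k + \<sigma>))) {\<sigma>..\<tau>}) \<and>
     (\<forall>k\<ge>1. (x \<longlongrightarrow> sysJ S *v x (t k) + sysBd S *v ud k + sysEd S *v wd k) (at_right (t k))) \<and>
     (\<forall>k. \<forall>\<tau>\<in>{0<..t (Suc k) - t k}.
        zc (t k + \<tau>) = sysCc S \<tau> *v x (t k + \<tau>) + sysDc S \<tau> *v uc (t k + \<tau>)
                        + sysFc S \<tau> *v wc (t k + \<tau>)) \<and>
     (\<forall>k\<ge>1. zd k = sysCd S *v x (t k) + sysDd S *v ud k + sysFd S *v wd k)"

definition control_law ::
  "(real \<Rightarrow> real^'n::finite^'mc::finite) \<Rightarrow> (real \<Rightarrow> real^'n^'md::finite) \<Rightarrow> (nat \<Rightarrow> real) \<Rightarrow>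
   (real \<Rightarrow> real^'n) \<Rightarrow> (real \<Rightarrow> real^'mc) \<Rightarrow> (nat \<Rightarrow> real^'md) \<Rightarrow> bool"
where
  "control_law Kc Kd t x uc ud \<longleftrightarrow>
     (\<forall>k. \<forall>\<tau>\<in>{0<..t (Suc k) - t k}. uc (t k + \<tau>) = Kc \<tau> *v x (t k + \<tau>)) \<and>
     (\<forall>k\<ge>1. ud k = Kd (t k - t (k - 1)) *v x (t k))"

definition closed_loop_trajectory where
  "closed_loop_trajectory S Kc Kd t x0 wc wd x zc zd \<longleftrightarrow>
     (\<exists>uc ud. control_law Kc Kd t x uc ud \<and> trajectory S t x0 uc ud wc wd x zc zd)"

text \<open>
  Asymptotic stability of the origin for a fixed impulse sequence, with zero exogenous inputs.
  Attractivity is required for all initial conditions (the system is linear).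
\<close>

definition asymptotically_stable where
  "asymptotically_stable S Kc Kd t \<longleftrightarrow>
     (\<forall>e>0. \<exists>d>0. \<forall>x0 x zc zd.
        norm x0 < d \<and> closed_loop_trajectory S Kc Kd t x0 (\<lambda>_. 0) (\<lambda>_. 0) x zc zd \<longrightarrow>
        (\<forall>s\<ge>0. norm (x s) < e)) \<and>
     (\<forall>x0 x zc zd.
        closed_loop_trajectory S Kc Kd t x0 (\<lambda>_. 0) (\<lambda>_. 0) x zc zd \<longrightarrow> (x \<longlongrightarrow> 0) at_top)"

definition Linf_norm :: "(real \<Rightarrow> real^'m::finite) \<Rightarrow> ereal" where
  "Linf_norm f = esssup (lebesgue_on {0..}) (\<lambda>s. ereal (infnorm (f s)))"

text \<open>Discrete signals are indexed by \<open>k \<ge> 1\<close>.\<close>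

definition linf_norm :: "(nat \<Rightarrow> real^'m::finite) \<Rightarrow> ereal" where
  "linf_norm f = (SUP k\<in>{1..}. ereal (infnorm (f k)))"

definition hybrid_gain where
  "hybrid_gain S Kc Kd Tmin Tmax =
     Sup {max (Linf_norm zc) (linf_norm zd) | zc zd t wc wd x.
            t \<in> range_dwell_time Tmin Tmax \<and>
            wc \<in> borel_measurable (lebesgue_on {0..}) \<and>
            max (Linf_norm wc) (linf_norm wd) = 1 \<and>
            closed_loop_trajectory S Kc Kd t 0 wc wd x zc zd}"

end

theory Submission
  imports Defs
begin

text \<open>
  A linear copositive argument in its \<open>L\<^sub>\<infinity>\<close> form. With the gains \<open>K = U X\<^sup>-\<^sup>1\<close>, multiplying a closed-loop matrix by
  \<open>X\<close> gives one of the expressions in the hypotheses (lemma \<open>inverse_gain_mult\<close>). Since \<open>X\<close> stays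
  diagonal with positive diagonal, the sign conditions say that the closed-loop flow matrix is
  Metzler and that the jump and output matrices are nonnegative, and the row-sum conditions become
  inequalities for the positive vector function \<open>lam = X 1\<close>, where 1 denotes the all-ones vector.

  These inequalities make \<open>lam\<close> a moving box that traps trajectories. On a flow interval,
  \<open>lam' \<ge> M lam + E 1\<close> and the comparison principle for Metzler systems (lemma
  \<open>metzler_flow_abs_le\<close>) show that \<open>\<bar>x\<bar> \<le> c lam\<close> persists if \<open>\<bar>w\<bar> \<le> c\<close> almost everywhere. At an
  impulse, the jump inequality maps the box \<open>\<bar>x\<bar> \<le> c lam\<close> into \<open>\<bar>x\<bar> \<le> c (lam 0 - \<epsilon>)\<close>, which lies
  strictly inside the initial box of the next interval. Induction over the impulses gives
  \<open>trajectory_envelope\<close>.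

  Without input, the strict inclusion contracts the box geometrically, and dwell times bounded above
  force infinitely many contractions; this is asymptotic stability (\<open>exponential_decay\<close>,
  \<open>asymptotic_stability\<close>). With inputs bounded by 1 and zero initial state, \<open>\<bar>x\<bar> \<le> lam\<close> holds forever,
  and the output inequalities are exactly the statement that the outputs are at most \<open>\<gamma>\<close> on that box
  (\<open>hybrid_gain_le\<close>).
\<close>

section \<open>Comparison for Metzler systems\<close>

text \<open>
  An integral form of the fact that \<open>y' \<ge> M y\<close> with a Metzler matrix \<open>M\<close> keeps the nonnegative
  orthant invariant. At the first time at which a component of \<open>y\<close> reaches zero, the diagonal entry
  of \<open>M\<close> multiplies zero and the other entries multiply nonnegative components, so that component
  is pushed upwards. To turn ``upwards'' into a strict inequality, \<open>y\<close> is first raised by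
  \<open>\<delta> exp (L s)\<close> in every component, where \<open>L\<close> exceeds all row sums of \<open>M\<close>. The integral form is
  what makes the lemma applicable to Caratheodory solutions: \<open>y\<close> is never differentiated.
\<close>

lemma metzler_integral_inequality_nonneg:
  fixes M :: "real \<Rightarrow> real^'n^'n" and y :: "real \<Rightarrow> real^'n"
  assumes contM: "continuous_on {0..T} M" and conty: "continuous_on {0..T} y"
    and metzler: "\<And>s i j. s \<in> {0..T} \<Longrightarrow> i \<noteq> j \<Longrightarrow> 0 \<le> M s $ i $ j"
    and y0: "\<And>i. 0 \<le> y 0 $ i"
    and growth: "\<And>\<sigma> \<tau> i. 0 < \<sigma> \<Longrightarrow> \<sigma> \<le> \<tau> \<Longrightarrow> \<tau> \<le> T \<Longrightarrow>
      integral {\<sigma>..\<tau>} (\<lambda>s. (M s *v y s) $ i) \<le> y \<tau> $ i - y \<sigma> $ i"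
    and \<tau>: "\<tau> \<in> {0..T}"
  shows "0 \<le> y \<tau> $ i"
proof -
  have contMij: "continuous_on {0..T} (\<lambda>s. M s $ i $ j)" for i j
    using contM by (intro continuous_intros)
  have contyi: "continuous_on {0..T} (\<lambda>s. y s $ i)" for i
    using conty by (intro continuous_intros)
  \<comment> \<open>A growth rate above all row sums of \<open>M\<close> lets the perturbation grow strictly faster than the flow of \<open>M\<close> would make it grow.\<close>
  have "\<exists>L>0. \<forall>s\<in>{0..T}. \<forall>i. (\<Sum>j\<in>UNIV. M s $ i $ j) < L"
  proof -
    have "bounded ((\<lambda>s. \<Sum>i\<in>UNIV. \<bar>\<Sum>j\<in>UNIV. M s $ i $ j\<bar>) ` {0..T})"
      by (intro compact_imp_bounded compact_continuous_image continuous_intros contMij compact_Icc)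
    then obtain L where L: "L > 0" "\<And>s. s \<in> {0..T} \<Longrightarrow> \<bar>\<Sum>i\<in>UNIV. \<bar>\<Sum>j\<in>UNIV. M s $ i $ j\<bar>\<bar> \<le> L"
      unfolding bounded_pos by auto
    have "(\<Sum>j\<in>UNIV. M s $ i $ j) < L + 1" if "s \<in> {0..T}" for s i
    proof -
      have "(\<Sum>j\<in>UNIV. M s $ i $ j) \<le> \<bar>\<Sum>j\<in>UNIV. M s $ i $ j\<bar>" by simp
      also have "\<dots> \<le> (\<Sum>i\<in>UNIV. \<bar>\<Sum>j\<in>UNIV. M s $ i $ j\<bar>)"
        by (rule member_le_sum) auto
      also have "\<dots> \<le> L" using L(2)[OF that] by linarith
      finally show ?thesis by simp
    qed
    then show ?thesis using L(1) by (intro exI[of _ "L+1"]) auto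
  qed
  then obtain L where L0: "L > 0"
    and L: "\<And>s i. s \<in> {0..T} \<Longrightarrow> (\<Sum>j\<in>UNIV. M s $ i $ j) < L" by blast
  have pert: "0 < y s $ i + \<delta> * exp (L * s)" if \<delta>: "\<delta> > 0" and "s \<in> {0..T}" for \<delta> s i
  proof (rule ccontr)
    assume neg: "\<not> 0 < y s $ i + \<delta> * exp (L * s)"
    define p where "p = (\<lambda>s. \<delta> * exp (L * s))"
    define z where "z = (\<lambda>i s. y s $ i + p s)"
    define Z where "Z = (\<Union>i. {s \<in> {0..T}. z i s \<le> 0})"
    have p: "p s > 0" for s using \<delta> by (simp add: p_def)
    have contp: "continuous_on {0..T} p" unfolding p_def by (intro continuous_intros)
    have contz: "continuous_on {0..T} (z i)" for i
      unfolding z_def by (intro continuous_intros contyi contp)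
    have "compact {s \<in> {0..T}. z i s \<le> 0}" for i
    proof -
      have "closed ({0..T} \<inter> z i -` {..0})"
        by (intro continuous_closed_preimage contz) auto
      then have "compact ({0..T} \<inter> ({0..T} \<inter> z i -` {..0}))"
        by (intro compact_Int_closed compact_Icc)
      moreover have "{0..T} \<inter> ({0..T} \<inter> z i -` {..0}) = {s \<in> {0..T}. z i s \<le> 0}" by auto
      ultimately show ?thesis by simp
    qed
    then have "compact Z" unfolding Z_def by (intro compact_UN) auto
    moreover have "s \<in> Z" using neg that(2) by (auto simp: Z_def z_def p_def not_less)
    ultimately obtain a where a: "a \<in> Z" "\<And>s. s \<in> Z \<Longrightarrow> a \<le> s"
      using compact_attains_inf[of Z] by blast
    \<comment> \<open>The point \<open>a\<close> is the first time at which some component, the \<open>k\<close>-th, is not positive.\<close>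
    from a(1) obtain k where k: "z k a \<le> 0" and aT: "0 \<le> a" "a \<le> T" by (auto simp: Z_def)
    have "z k 0 > 0" using y0[of k] p[of 0] by (simp add: z_def add_nonneg_pos)
    with k aT have a0: "a > 0" by (cases "a = 0") auto
    have before: "z j s > 0" if "0 \<le> s" "s < a" for j s
    proof (rule ccontr)
      assume "\<not> 0 < z j s"
      with that aT have "s \<in> Z" by (auto simp: Z_def not_less)
      with a(2)[of s] that show False by simp
    qed
    have at_a: "z j a \<ge> 0" for j
    proof -
      have "continuous_on {0..a} (z j)" by (rule continuous_on_subset[OF contz]) (use aT in auto)
      then have "(z j \<longlongrightarrow> z j a) (at_left a)"
        using a0 by (simp add: continuous_on_Icc_at_leftD)
      moreover have "\<forall>\<^sub>F s in at_left a. 0 \<le> z j s"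
        using eventually_at_left_real[OF a0] by eventually_elim (simp add: before less_imp_le)
      ultimately show ?thesis
        by (intro tendsto_lowerbound) auto
    qed
    \<comment> \<open>The integrand that bounds the growth of \<open>z k\<close> from below is positive at \<open>a\<close>, hence just before \<open>a\<close>.\<close>
    define h where "h = (\<lambda>s. (M s *v y s) $ k + L * p s)"
    have conth: "continuous_on {0..T} h"
      unfolding h_def matrix_vector_mult_def vec_lambda_beta
      by (intro continuous_intros contMij contyi contp)
    have "h a > 0"
    proof -
      have "(M a *v y a) $ k = (\<Sum>j\<in>UNIV. M a $ k $ j * z j a) - p a * (\<Sum>j\<in>UNIV. M a $ k $ j)"
        unfolding matrix_vector_mult_def z_def
        by (simp add: sum_distrib_left sum_subtractf[symmetric] algebra_simps)
      moreover have "0 \<le> (\<Sum>j\<in>UNIV. M a $ k $ j * z j a)"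
      proof (rule sum_nonneg)
        fix j
        show "0 \<le> M a $ k $ j * z j a"
          using k at_a[of k] at_a[of j] metzler[of a k j] aT by (cases "j = k") auto
      qed
      moreover have "p a * (\<Sum>j\<in>UNIV. M a $ k $ j) < p a * L"
        using L[of a k] aT p[of a] by simp
      ultimately show ?thesis by (simp add: h_def algebra_simps)
    qed
    have "(h \<longlongrightarrow> h a) (at_left a)"
    proof -
      have "continuous_on {0..a} h" by (rule continuous_on_subset[OF conth]) (use aT in auto)
      then show ?thesis using a0 by (simp add: continuous_on_Icc_at_leftD)
    qed
    then have "\<forall>\<^sub>F s in at_left a. h s > 0"
      using \<open>h a > 0\<close> by (rule order_tendstoD)
    then obtain b where b: "b < a" "\<And>s. b < s \<Longrightarrow> s < a \<Longrightarrow> h s > 0"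
      unfolding eventually_at_left_field by blast
    define r where "r = (max b 0 + a) / 2"
    have r: "0 < r" "r < a" "b < r" using b(1) a0 by (auto simp: r_def field_simps max_def)
    have hpos: "h s \<ge> 0" if "s \<in> {r..a}" for s
      using that r b(2)[of s] \<open>h a > 0\<close> by (cases "s = a") (auto simp: less_imp_le)
    have contMy: "continuous_on {r..a} (\<lambda>s. (M s *v y s) $ k)"
    proof (rule continuous_on_subset[of "{0..T}"])
      show "continuous_on {0..T} (\<lambda>s. (M s *v y s) $ k)"
        unfolding matrix_vector_mult_def vec_lambda_beta
        by (intro continuous_intros contMij contyi)
    qed (use r aT in auto)
    have "((\<lambda>s. L * p s) has_integral (p a - p r)) {r..a}"
      unfolding p_def
      by (rule fundamental_theorem_of_calculus)
        (use r in \<open>auto intro!: derivative_eq_intros simp: has_real_derivative_iff_has_vector_derivative[symmetric]\<close>)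
    moreover have "((\<lambda>s. (M s *v y s) $ k) has_integral integral {r..a} (\<lambda>s. (M s *v y s) $ k)) {r..a}"
      using integrable_continuous_real[OF contMy] by (simp add: integrable_integral)
    ultimately have "(h has_integral (integral {r..a} (\<lambda>s. (M s *v y s) $ k) + (p a - p r))) {r..a}"
      unfolding h_def by (intro has_integral_add)
    then have "0 \<le> integral {r..a} (\<lambda>s. (M s *v y s) $ k) + (p a - p r)"
      by (rule has_integral_nonneg) (rule hpos)
    also have "\<dots> \<le> z k a - z k r"
      using growth[of r a k] r aT by (simp add: z_def)
    finally show False using k before[of r k] r by simp
  qed
  show ?thesis
  proof (rule ccontr)
    assume "\<not> 0 \<le> y \<tau> $ i"
    then show False using pert[of "- y \<tau> $ i / exp (L * \<tau>)" \<tau> i] \<tau> by (simp add: field_simps)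
  qed
qed

lemma has_integral_vec_nth:
  "(f has_integral I) A \<Longrightarrow> ((\<lambda>s. f s $ i) has_integral (I $ i)) A"
  for f :: "real \<Rightarrow> real^'n"
  using has_integral_linear[OF _ bounded_linear_vec_nth, of f I A i] by (simp add: o_def)

text \<open>
  The difference \<open>c lam - x\<close> satisfies the integral inequality of the previous lemma. Since \<open>lam\<close> is
  differentiable everywhere, the Henstock-Kurzweil fundamental theorem recovers it from \<open>lam'\<close>
  even where \<open>lam'\<close> is not Lebesgue integrable, and the null set on which the input bound fails
  does not change the integral.
\<close>

lemma metzler_comparison:
  fixes M :: "real \<Rightarrow> real^'n^'n" and E :: "real \<Rightarrow> real^'p^'n" and lam lam' x :: "real \<Rightarrow> real^'n"
    and w :: "real \<Rightarrow> real^'p"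
  assumes contM: "continuous_on {0..T} M"
    and metzler: "\<And>s i j. s \<in> {0..T} \<Longrightarrow> i \<noteq> j \<Longrightarrow> 0 \<le> M s $ i $ j"
    and E: "\<And>s i j. s \<in> {0..T} \<Longrightarrow> 0 \<le> E s $ i $ j"
    and lam: "\<And>s. s \<in> {0..T} \<Longrightarrow> (lam has_vector_derivative lam' s) (at s within {0..T})"
    and super: "\<And>s i. s \<in> {0..T} \<Longrightarrow> (M s *v lam s + E s *v 1) $ i \<le> lam' s $ i"
    and contx: "continuous_on {0..T} x"
    and flow: "\<And>\<sigma> \<tau>. 0 < \<sigma> \<Longrightarrow> \<sigma> \<le> \<tau> \<Longrightarrow> \<tau> \<le> T \<Longrightarrow>
      ((\<lambda>s. M s *v x s + E s *v w s) has_integral (x \<tau> - x \<sigma>)) {\<sigma>..\<tau>}"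
    and N: "negligible N" and w: "\<And>s j. s \<in> {0<..T} - N \<Longrightarrow> w s $ j \<le> c"
    and c: "0 \<le> c" and x0: "\<And>i. x 0 $ i \<le> c * lam 0 $ i"
    and \<tau>: "\<tau> \<in> {0..T}"
  shows "x \<tau> $ i \<le> c * lam \<tau> $ i"
proof -
  have contlam: "continuous_on {0..T} lam"
    using lam by (rule continuous_on_vector_derivative)
  have "0 \<le> (c *\<^sub>R lam \<tau> - x \<tau>) $ i"
  proof (rule metzler_integral_inequality_nonneg[OF contM _ metzler _ _ \<tau>])
    show conty: "continuous_on {0..T} (\<lambda>s. c *\<^sub>R lam s - x s)"
      by (intro continuous_intros contlam contx)
    show "0 \<le> (c *\<^sub>R lam 0 - x 0) $ i" for i using x0[of i] by simp
    fix \<sigma> \<tau> i assume st: "0 < \<sigma>" "\<sigma> \<le> \<tau>" "\<tau> \<le> T"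
    define g where "g = (\<lambda>s. c * lam' s $ i - (M s *v x s + E s *v w s) $ i)"
    have "(lam' has_integral (lam \<tau> - lam \<sigma>)) {\<sigma>..\<tau>}"
      by (rule fundamental_theorem_of_calculus)
        (use st in \<open>auto intro: has_vector_derivative_within_subset[OF lam]\<close>)
    from has_integral_mult_right[OF has_integral_vec_nth[OF this, of i], of c]
    have "((\<lambda>s. c * lam' s $ i) has_integral c * (lam \<tau> - lam \<sigma>) $ i) {\<sigma>..\<tau>}" .
    from has_integral_diff[OF this has_integral_vec_nth[OF flow[OF st], of i]]
    have g: "(g has_integral ((c *\<^sub>R lam \<tau> - x \<tau>) $ i - (c *\<^sub>R lam \<sigma> - x \<sigma>) $ i)) {\<sigma>..\<tau>}"
      by (simp add: g_def algebra_simps)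
    let ?f = "\<lambda>s. (M s *v (c *\<^sub>R lam s - x s)) $ i"
    have "continuous_on {\<sigma>..\<tau>} ?f"
    proof (rule continuous_on_subset[of "{0..T}"])
      show "continuous_on {0..T} ?f"
        unfolding matrix_vector_mult_def vec_lambda_beta
        by (intro continuous_intros conty contM contlam contx)
    qed (use st in auto)
    then have f: "(?f has_integral integral {\<sigma>..\<tau>} ?f) {\<sigma>..\<tau>}"
      by (intro integrable_integral integrable_continuous_real)
    have le: "?f s \<le> g s" if s: "s \<in> {\<sigma>..\<tau>} - N" for s
    proof -
      have s': "s \<in> {0..T}" using s st by auto
      have "(E s *v w s) $ i \<le> (\<Sum>j\<in>UNIV. E s $ i $ j * c)"
        unfolding matrix_vector_mult_def vec_lambda_beta
        using E[OF s'] w[of s] s st by (intro sum_mono mult_left_mono) auto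
      also have "\<dots> = c * (E s *v 1) $ i"
        by (simp add: matrix_vector_mult_def sum_distrib_left mult.commute)
      finally have Ew: "(E s *v w s) $ i \<le> c * (E s *v 1) $ i" .
      have "c * (M s *v lam s) $ i + c * (E s *v 1) $ i \<le> c * lam' s $ i"
        using mult_left_mono[OF super[OF s', of i] c] by (simp add: algebra_simps)
      then show ?thesis
        using Ew by (simp add: g_def matrix_vector_mult_diff_distrib matrix_vector_mult_scaleR)
    qed
    \<comment> \<open>Changing \<open>g\<close> on the null set makes the pointwise inequality hold everywhere.\<close>
    have "((\<lambda>s. if s \<in> N then ?f s else g s) has_integral ((c *\<^sub>R lam \<tau> - x \<tau>) $ i - (c *\<^sub>R lam \<sigma> - x \<sigma>) $ i)) {\<sigma>..\<tau>}"
      by (rule has_integral_spike[OF N _ g]) auto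
    from has_integral_le[OF f this]
    show "integral {\<sigma>..\<tau>} ?f \<le> (c *\<^sub>R lam \<tau> - x \<tau>) $ i - (c *\<^sub>R lam \<sigma> - x \<sigma>) $ i"
      using le by auto
  qed
  then show ?thesis by simp
qed

text \<open>
  The dynamics are linear, so the one-sided comparison applies to \<open>(x, w)\<close> and to \<open>(- x, - w)\<close>.
\<close>

lemma metzler_flow_abs_le:
  fixes M :: "real \<Rightarrow> real^'n^'n" and E :: "real \<Rightarrow> real^'p^'n" and lam lam' x :: "real \<Rightarrow> real^'n"
    and w :: "real \<Rightarrow> real^'p"
  assumes contM: "continuous_on {0..T} M"
    and metzler: "\<And>s i j. s \<in> {0..T} \<Longrightarrow> i \<noteq> j \<Longrightarrow> 0 \<le> M s $ i $ j"
    and E: "\<And>s i j. s \<in> {0..T} \<Longrightarrow> 0 \<le> E s $ i $ j"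
    and lam: "\<And>s. s \<in> {0..T} \<Longrightarrow> (lam has_vector_derivative lam' s) (at s within {0..T})"
    and super: "\<And>s i. s \<in> {0..T} \<Longrightarrow> (M s *v lam s + E s *v 1) $ i \<le> lam' s $ i"
    and contx: "continuous_on {0..T} x"
    and flow: "\<And>\<sigma> \<tau>. 0 < \<sigma> \<Longrightarrow> \<sigma> \<le> \<tau> \<Longrightarrow> \<tau> \<le> T \<Longrightarrow>
      ((\<lambda>s. M s *v x s + E s *v w s) has_integral (x \<tau> - x \<sigma>)) {\<sigma>..\<tau>}"
    and N: "negligible N" and w: "\<And>s j. s \<in> {0<..T} - N \<Longrightarrow> \<bar>w s $ j\<bar> \<le> c"
    and c: "0 \<le> c" and x0: "\<And>i. \<bar>x 0 $ i\<bar> \<le> c * lam 0 $ i"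
    and \<tau>: "\<tau> \<in> {0..T}"
  shows "\<bar>x \<tau> $ i\<bar> \<le> c * lam \<tau> $ i"
proof -
  have neg: "P *v (- v) = - (P *v v)" for P :: "real^'a^'b" and v
    using matrix_vector_mult_scaleR[of P "-1" v] by simp
  have "x \<tau> $ i \<le> c * lam \<tau> $ i"
    by (rule metzler_comparison[OF contM metzler E lam super contx flow N _ c _ \<tau>])
      (use w x0 in \<open>auto simp: abs_le_iff\<close>)
  moreover have "(- x \<tau>) $ i \<le> c * lam \<tau> $ i"
  proof (rule metzler_comparison[OF contM metzler E lam super _ _ N _ c _ \<tau>, where w = "\<lambda>s. - w s"])
    show "continuous_on {0..T} (\<lambda>s. - x s)" by (intro continuous_intros contx)
    show "((\<lambda>s. M s *v - x s + E s *v - w s) has_integral - x \<tau> - - x \<sigma>) {\<sigma>..\<tau>}"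
      if "0 < \<sigma>" "\<sigma> \<le> \<tau>" "\<tau> \<le> T" for \<sigma> \<tau>
      using has_integral_neg[OF flow[OF that]] by (simp add: neg algebra_simps)
  qed (use w x0 in \<open>auto simp: abs_le_iff\<close>)
  ultimately show ?thesis by (simp add: abs_le_iff)
qed

text \<open>
  The static counterpart of the comparison for the flow: for nonnegative matrices the worst case over
  the boxes \<open>\<bar>x\<bar> \<le> c lam\<close> and \<open>\<bar>w\<bar> \<le> c\<close> is attained at their upper corner. It serves the jump map and
  both output maps.
\<close>

lemma abs_nonneg_combination_le:
  fixes P :: "real^'n^'q" and F :: "real^'p^'q"
  assumes "\<And>i j. 0 \<le> P $ i $ j" "\<And>i j. 0 \<le> F $ i $ j"
    and "\<And>j. \<bar>x $ j\<bar> \<le> c * lam $ j" "\<And>j. \<bar>w $ j\<bar> \<le> c"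
  shows "\<bar>(P *v x + F *v w) $ i\<bar> \<le> c * (P *v lam + F *v 1) $ i"
proof -
  have "\<bar>(P *v x + F *v w) $ i\<bar> \<le> (\<Sum>j\<in>UNIV. \<bar>P $ i $ j * x $ j\<bar>) + (\<Sum>j\<in>UNIV. \<bar>F $ i $ j * w $ j\<bar>)"
    unfolding matrix_vector_mult_def vector_add_component vec_lambda_beta
    by (intro order_trans[OF abs_triangle_ineq] add_mono sum_abs)
  also have "\<dots> \<le> (\<Sum>j\<in>UNIV. P $ i $ j * (c * lam $ j)) + (\<Sum>j\<in>UNIV. F $ i $ j * c)"
    using assms by (intro add_mono sum_mono) (auto simp: abs_mult intro!: mult_left_mono)
  also have "\<dots> = c * (P *v lam + F *v 1) $ i"
    by (simp add: matrix_vector_mult_def sum_distrib_left algebra_simps)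
  finally show ?thesis .
qed

section \<open>Trajectories of the closed loop\<close>

definition closed_flow where
  "closed_flow S Kc \<tau> = sysA S \<tau> + sysBc S \<tau> ** Kc \<tau>"
definition closed_jump where
  "closed_jump S Kd \<theta> = sysJ S + sysBd S ** Kd \<theta>"
definition closed_flow_output where
  "closed_flow_output S Kc \<tau> = sysCc S \<tau> + sysDc S \<tau> ** Kc \<tau>"
definition closed_jump_output where
  "closed_jump_output S Kd \<theta> = sysCd S + sysDd S ** Kd \<theta>"

lemma feedback_mult_vector:
  "A *v x + B *v (K *v x) = (A + B ** K) *v x"
  by (simp add: matrix_vector_mult_add_rdistrib matrix_vector_mul_assoc)

text \<open>
  Substituting the control law eliminates the control signals: only the closed-loop matrices appear.
  Impulses are indexed as \<open>Suc k\<close>, the end of the \<open>k\<close>-th interval.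
\<close>

lemma closed_loop_trajectoryD:
  assumes "closed_loop_trajectory S Kc Kd t x0 wc wd x zc zd"
  shows closed_loop_initial: "x 0 = x0" "(x \<longlongrightarrow> x0) (at_right 0)"
    and closed_loop_flow: "0 < \<sigma> \<Longrightarrow> \<sigma> \<le> \<tau> \<Longrightarrow> \<tau> \<le> t (Suc k) - t k \<Longrightarrow>
      ((\<lambda>s. closed_flow S Kc s *v x (t k + s) + sysEc S s *v wc (t k + s))
        has_integral (x (t k + \<tau>) - x (t k + \<sigma>))) {\<sigma>..\<tau>}"
    and closed_loop_jump: "(x \<longlongrightarrow> closed_jump S Kd (t (Suc k) - t k) *v x (t (Suc k))
      + sysEd S *v wd (Suc k)) (at_right (t (Suc k)))"
    and closed_loop_flow_output: "0 < \<tau> \<Longrightarrow> \<tau> \<le> t (Suc k) - t k \<Longrightarrow>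
      zc (t k + \<tau>) = closed_flow_output S Kc \<tau> *v x (t k + \<tau>) + sysFc S \<tau> *v wc (t k + \<tau>)"
    and closed_loop_jump_output:
      "zd (Suc k) = closed_jump_output S Kd (t (Suc k) - t k) *v x (t (Suc k)) + sysFd S *v wd (Suc k)"
proof -
  from assms obtain uc ud where law: "control_law Kc Kd t x uc ud"
    and traj: "trajectory S t x0 uc ud wc wd x zc zd"
    unfolding closed_loop_trajectory_def by blast
  have uc: "uc (t k + \<tau>) = Kc \<tau> *v x (t k + \<tau>)" if "0 < \<tau>" "\<tau> \<le> t (Suc k) - t k" for k \<tau>
    using law that unfolding control_law_def by auto
  have ud: "ud (Suc k) = Kd (t (Suc k) - t k) *v x (t (Suc k))" for k
    using law unfolding control_law_def by (auto dest: spec[of _ "Suc k"])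
  show "x 0 = x0" "(x \<longlongrightarrow> x0) (at_right 0)"
    using traj unfolding trajectory_def by blast+
  show "(x \<longlongrightarrow> closed_jump S Kd (t (Suc k) - t k) *v x (t (Suc k))
      + sysEd S *v wd (Suc k)) (at_right (t (Suc k)))"
  proof -
    have "(x \<longlongrightarrow> sysJ S *v x (t (Suc k)) + sysBd S *v ud (Suc k) + sysEd S *v wd (Suc k)) (at_right (t (Suc k)))"
      using traj unfolding trajectory_def by simp
    then show ?thesis by (simp only: ud feedback_mult_vector closed_jump_def)
  qed
  show "zd (Suc k) = closed_jump_output S Kd (t (Suc k) - t k) *v x (t (Suc k)) + sysFd S *v wd (Suc k)"
  proof -
    have "zd (Suc k) = sysCd S *v x (t (Suc k)) + sysDd S *v ud (Suc k) + sysFd S *v wd (Suc k)"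
      using traj unfolding trajectory_def by simp
    then show ?thesis by (simp only: ud feedback_mult_vector closed_jump_output_def)
  qed
  show "zc (t k + \<tau>) = closed_flow_output S Kc \<tau> *v x (t k + \<tau>) + sysFc S \<tau> *v wc (t k + \<tau>)"
    if "0 < \<tau>" "\<tau> \<le> t (Suc k) - t k"
  proof -
    have "zc (t k + \<tau>) = sysCc S \<tau> *v x (t k + \<tau>) + sysDc S \<tau> *v uc (t k + \<tau>) + sysFc S \<tau> *v wc (t k + \<tau>)"
      using traj that unfolding trajectory_def by auto
    then show ?thesis by (simp only: uc[OF that] feedback_mult_vector closed_flow_output_def)
  qed
  show "((\<lambda>s. closed_flow S Kc s *v x (t k + s) + sysEc S s *v wc (t k + s))
        has_integral (x (t k + \<tau>) - x (t k + \<sigma>))) {\<sigma>..\<tau>}"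
    if "0 < \<sigma>" "\<sigma> \<le> \<tau>" "\<tau> \<le> t (Suc k) - t k"
  proof -
    have "((\<lambda>s. sysA S s *v x (t k + s) + sysBc S s *v uc (t k + s) + sysEc S s *v wc (t k + s))
          has_integral (x (t k + \<tau>) - x (t k + \<sigma>))) {\<sigma>..\<tau>}"
      using traj that unfolding trajectory_def by blast
    then show ?thesis
      by (rule has_integral_eq[rotated])
        (use that in \<open>simp add: uc feedback_mult_vector closed_flow_def\<close>)
  qed
qed

text \<open>
  The state at an impulse time is the value before the jump. The flow on the following interval
  becomes a continuous function on a compact interval once that value is replaced by the right limit.
\<close>

lemma continuous_on_flow_with_right_limit:
  fixes x :: "real \<Rightarrow> 'a::banach"
  assumes lim: "(x \<longlongrightarrow> x\<^sub>0) (at_right a)"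
    and flow: "\<And>\<sigma> \<tau>. 0 < \<sigma> \<Longrightarrow> \<sigma> \<le> \<tau> \<Longrightarrow> \<tau> \<le> T \<Longrightarrow>
      (f has_integral (x (a + \<tau>) - x (a + \<sigma>))) {\<sigma>..\<tau>}"
  shows "continuous_on {0..T} (\<lambda>s. if s = 0 then x\<^sub>0 else x (a + s))"
  unfolding continuous_on_def
proof
  fix s assume s: "s \<in> {0..T}"
  let ?g = "\<lambda>s. if s = 0 then x\<^sub>0 else x (a + s)"
  show "(?g \<longlongrightarrow> ?g s) (at s within {0..T})"
  proof (cases "s = 0")
    case True
    have "((\<lambda>s. x (a + s)) \<longlongrightarrow> x\<^sub>0) (at_right 0)"
      using lim unfolding filterlim_at_right_to_0[of _ _ a] by (simp add: add.commute)
    then have "(?g \<longlongrightarrow> x\<^sub>0) (at_right 0)"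
      by (rule Lim_transform_eventually)
        (simp add: eventually_at_filter)
    then have "(?g \<longlongrightarrow> x\<^sub>0) (at 0 within {0..T})"
      unfolding at_within_def
      by (rule tendsto_mono[rotated]) (rule inf_mono, auto)
    then show ?thesis using True by simp
  next
    case False
    \<comment> \<open>The integral equation is available only away from zero; near \<open>s\<close> this is no restriction.\<close>
    define \<sigma> where "\<sigma> = s / 2"
    have \<sigma>: "0 < \<sigma>" "\<sigma> < s" "\<sigma> \<le> T" using s False by (auto simp: \<sigma>_def)
    have "continuous_on {\<sigma>..T} (\<lambda>\<tau>. x (a + \<sigma>) + integral {\<sigma>..\<tau>} f)"
      by (intro continuous_intros indefinite_integral_continuous_1
          has_integral_integrable[OF flow]) (use \<sigma> in auto)
    moreover have "x (a + \<sigma>) + integral {\<sigma>..\<tau>} f = ?g \<tau>" if "\<tau> \<in> {\<sigma>..T}" for \<tau>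
      using that \<sigma> integral_unique[OF flow[of \<sigma> \<tau>]] by auto
    ultimately have "continuous_on {\<sigma>..T} ?g" by (rule continuous_on_eq)
    then have "(?g \<longlongrightarrow> ?g s) (at s within {\<sigma>..T})"
      using s \<sigma> unfolding continuous_on_def by auto
    moreover have "at s within {\<sigma>..T} = at s within {0..T}"
      by (rule at_within_nhd[of _ "{\<sigma><..}"]) (use \<sigma> in auto)
    ultimately show ?thesis by simp
  qed
qed

lemma dwell_time_bounds:
  assumes "t \<in> range_dwell_time Tmin Tmax"
  shows "real k * Tmin \<le> t k" "t k \<le> real k * Tmax"
proof -
  have step: "Tmin \<le> t (Suc j) - t j" "t (Suc j) - t j \<le> Tmax" and "t 0 = 0" for j
    using assms by (auto simp: range_dwell_time_def)
  have "real k * Tmin \<le> t k \<and> t k \<le> real k * Tmax"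
  proof (induction k)
    case (Suc k)
    then show ?case using step[of k] by (simp add: distrib_right)
  qed (simp add: \<open>t 0 = 0\<close>)
  then show "real k * Tmin \<le> t k" "t k \<le> real k * Tmax" by auto
qed

text \<open>
  The lower dwell-time bound excludes accumulation of impulses, so the flow intervals cover all
  positive times.
\<close>

lemma dwell_time_interval_exists:
  assumes t: "t \<in> range_dwell_time Tmin Tmax" and "0 < Tmin" "0 < s"
  obtains k where "t k < s" "s \<le> t (Suc k)"
proof -
  obtain m where "s < real m * Tmin" using reals_Archimedean3[OF \<open>0 < Tmin\<close>] by blast
  with dwell_time_bounds(1)[OF t, of m] have m: "s \<le> t m" by simp
  define n where "n = (LEAST m. s \<le> t m)"
  have n: "s \<le> t n" unfolding n_def using m by (rule LeastI)
  have "t 0 = 0" using t by (simp add: range_dwell_time_def)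
  with n \<open>0 < s\<close> obtain k where k: "n = Suc k" by (cases n) auto
  have "\<not> s \<le> t k" using not_less_Least[of k "\<lambda>m. s \<le> t m"] k by (simp add: n_def)
  with n k that[of k] show thesis by simp
qed

section \<open>The envelope and asymptotic stability\<close>

text \<open>
  The conditions on \<open>X\<close> in the coordinates of the closed loop. Because \<open>X\<close> is diagonal, the positive
  vector function \<open>lam = X 1\<close> contains all of its information. It is a supersolution of the flow
  driven by the input \<open>1\<close>, and the jump map with that input takes its value at
  any admissible dwell time strictly below its initial value.
\<close>

locale stability_certificate =
  fixes S :: "('n::finite, 'mc::finite, 'md::finite, 'pc::finite, 'pd::finite, 'qc::finite, 'qd::finite)
                impulsive_system"
    and Kc :: "real \<Rightarrow> real^'n^'mc" and Kd :: "real \<Rightarrow> real^'n^'md"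
    and lam lam' :: "real \<Rightarrow> real^'n" and Tmin Tmax \<epsilon> :: real
  assumes Tmin: "0 < Tmin" "Tmin \<le> Tmax" and \<epsilon>: "0 < \<epsilon>"
    and continuous_flow: "continuous_on {0..Tmax} (closed_flow S Kc)"
    and metzler: "\<And>\<tau> i j. \<tau> \<in> {0..Tmax} \<Longrightarrow> i \<noteq> j \<Longrightarrow> 0 \<le> closed_flow S Kc \<tau> $ i $ j"
    and Ec_nonneg: "\<And>\<tau> i j. \<tau> \<in> {0..Tmax} \<Longrightarrow> 0 \<le> sysEc S \<tau> $ i $ j"
    and jump_nonneg: "\<And>\<theta> i j. \<theta> \<in> {Tmin..Tmax} \<Longrightarrow> 0 \<le> closed_jump S Kd \<theta> $ i $ j"
    and Ed_nonneg: "\<And>i j. 0 \<le> sysEd S $ i $ j"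
    and lam_pos: "\<And>\<tau> i. \<tau> \<in> {0..Tmax} \<Longrightarrow> 0 < lam \<tau> $ i"
    and lam_deriv: "\<And>\<tau>. \<tau> \<in> {0..Tmax} \<Longrightarrow> (lam has_vector_derivative lam' \<tau>) (at \<tau> within {0..Tmax})"
    and flow_le: "\<And>\<tau> i. \<tau> \<in> {0..Tmax} \<Longrightarrow>
      (closed_flow S Kc \<tau> *v lam \<tau> + sysEc S \<tau> *v 1) $ i \<le> lam' \<tau> $ i"
    and jump_le: "\<And>\<theta> i. \<theta> \<in> {Tmin..Tmax} \<Longrightarrow>
      (closed_jump S Kd \<theta> *v lam \<theta> + sysEd S *v 1) $ i \<le> lam 0 $ i - \<epsilon>"
begin

text \<open>
  One induction over the impulses covers stability and gain. On the \<open>k\<close>-th interval the box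
  \<open>\<bar>x\<bar> \<le> c k lam\<close> is invariant under the flow as long as the input is bounded by \<open>c k\<close>, and the
  jump leads from it into the next box whenever \<open>c k (lam 0 - \<epsilon>) \<le> c (k + 1) lam 0\<close>. A geometric
  sequence \<open>c\<close> is admissible for zero input, the constant sequence 1 for inputs bounded by 1.
\<close>

lemma trajectory_envelope:
  assumes t: "t \<in> range_dwell_time Tmin Tmax"
    and traj: "closed_loop_trajectory S Kc Kd t x0 wc wd x zc zd"
    and x0: "\<And>i. \<bar>x0 $ i\<bar> \<le> c 0 * lam 0 $ i"
    and N: "negligible N"
    and wc: "\<And>k s j. s \<in> {t k<..t (Suc k)} - N \<Longrightarrow> \<bar>wc s $ j\<bar> \<le> c k"
    and wd: "\<And>k j. \<bar>wd (Suc k) $ j\<bar> \<le> c k"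
    and c: "\<And>k. 0 \<le> c k" "\<And>k i. c k * (lam 0 $ i - \<epsilon>) \<le> c (Suc k) * lam 0 $ i"
    and s: "t k < s" "s \<le> t (Suc k)"
  shows "\<bar>x s $ i\<bar> \<le> c k * lam (s - t k) $ i"
proof -
  have T: "t (Suc k) - t k \<in> {Tmin..Tmax}" for k
    using t by (auto simp: range_dwell_time_def)
  have step: "\<bar>x (t k + \<tau>) $ i\<bar> \<le> c k * lam \<tau> $ i"
    if lim: "(x \<longlongrightarrow> xp) (at_right (t k))" and xp: "\<And>i. \<bar>xp $ i\<bar> \<le> c k * lam 0 $ i"
      and \<tau>: "0 < \<tau>" "\<tau> \<le> t (Suc k) - t k" for k xp \<tau> i
  proof -
    let ?T = "t (Suc k) - t k"
    let ?x = "\<lambda>s. if s = 0 then xp else x (t k + s)"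
    have sub: "{0..?T} \<subseteq> {0..Tmax}" using T[of k] by auto
    have "\<bar>?x \<tau> $ i\<bar> \<le> c k * lam \<tau> $ i"
    proof (rule metzler_flow_abs_le[where M = "closed_flow S Kc" and E = "sysEc S" and lam' = lam'
          and T = ?T and N = "(+) (- t k) ` N" and w = "\<lambda>s. wc (t k + s)"])
      show "continuous_on {0..?T} (closed_flow S Kc)"
        by (rule continuous_on_subset[OF continuous_flow sub])
      show "(lam has_vector_derivative lam' s) (at s within {0..?T})" if "s \<in> {0..?T}" for s
        using that sub by (intro has_vector_derivative_within_subset[OF lam_deriv]) auto
      show "continuous_on {0..?T} ?x"
        by (rule continuous_on_flow_with_right_limit[OF lim closed_loop_flow[OF traj]])
      show "((\<lambda>s. closed_flow S Kc s *v ?x s + sysEc S s *v wc (t k + s)) has_integral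
          ?x b - ?x a) {a..b}" if "0 < a" "a \<le> b" "b \<le> ?T" for a b
        using closed_loop_flow[OF traj that] that by (auto elim!: has_integral_eq[rotated])
      show "negligible ((+) (- t k) ` N)" by (rule negligible_translation[OF N])
      show "\<bar>wc (t k + s) $ j\<bar> \<le> c k" if "s \<in> {0<..?T} - (+) (- t k) ` N" for s j
      proof (rule wc)
        have "t k + s \<notin> N"
        proof
          assume "t k + s \<in> N"
          then have "- t k + (t k + s) \<in> (+) (- t k) ` N" by (rule imageI)
          with that show False by simp
        qed
        with that show "t k + s \<in> {t k<..t (Suc k)} - N" by auto
      qed
      show "(closed_flow S Kc s *v lam s + sysEc S s *v 1) $ i \<le> lam' s $ i"
        if "s \<in> {0..?T}" for s i
        using that sub by (intro flow_le) auto
    qed (use sub xp c(1) \<tau> in \<open>auto intro: metzler Ec_nonneg\<close>)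
    then show ?thesis using \<tau> by simp
  qed
  have "\<bar>x (t k + \<tau>) $ i\<bar> \<le> c k * lam \<tau> $ i" if "0 < \<tau>" "\<tau> \<le> t (Suc k) - t k" for k \<tau> i
    using that
  proof (induction k arbitrary: \<tau> i)
    case 0
    have "t 0 = 0" using t by (simp add: range_dwell_time_def)
    with closed_loop_initial(2)[OF traj] have "(x \<longlongrightarrow> x0) (at_right (t 0))" by simp
    from step[OF this x0] 0 show ?case by blast
  next
    case (Suc k)
    let ?T = "t (Suc k) - t k"
    have T0: "0 < ?T" using T[of k] Tmin by auto
    show ?case
    proof (rule step[OF closed_loop_jump[OF traj] _ Suc.prems])
      fix i
      have x: "\<bar>x (t (Suc k)) $ j\<bar> \<le> c k * lam ?T $ j" for j
        using Suc.IH[OF T0, of j] by simp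
      have "\<bar>(closed_jump S Kd ?T *v x (t (Suc k)) + sysEd S *v wd (Suc k)) $ i\<bar>
          \<le> c k * (closed_jump S Kd ?T *v lam ?T + sysEd S *v 1) $ i"
        by (rule abs_nonneg_combination_le[OF jump_nonneg[OF T] Ed_nonneg x wd])
      also have "\<dots> \<le> c k * (lam 0 $ i - \<epsilon>)"
        by (rule mult_left_mono[OF jump_le[OF T] c(1)])
      also have "\<dots> \<le> c (Suc k) * lam 0 $ i" by (rule c(2))
      finally show "\<bar>(closed_jump S Kd ?T *v x (t (Suc k)) + sysEd S *v wd (Suc k)) $ i\<bar>
        \<le> c (Suc k) * lam 0 $ i" .
    qed
  qed
  from this[of "s - t k" k i] s show ?thesis by simp
qed

lemma lam_bounded: "\<exists>B>0. \<forall>\<tau>\<in>{0..Tmax}. \<forall>i. lam \<tau> $ i \<le> B"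
proof -
  have "continuous_on {0..Tmax} lam" using lam_deriv by (rule continuous_on_vector_derivative)
  then have "bounded (lam ` {0..Tmax})" by (intro compact_imp_bounded compact_continuous_image) auto
  then obtain B where "B > 0" "\<And>\<tau>. \<tau> \<in> {0..Tmax} \<Longrightarrow> norm (lam \<tau>) \<le> B"
    unfolding bounded_pos by auto
  then show ?thesis
    by (meson abs_le_D1 component_le_norm_cart order_trans)
qed

text \<open>
  If \<open>B\<close> bounds \<open>lam\<close>, then \<open>lam 0 - \<epsilon> \<le> (1 - \<epsilon> / B) lam 0\<close>, so with zero input the envelope
  contracts by the factor \<open>1 - \<epsilon> / B\<close> at each impulse. The upper dwell-time bound enters through
  the boundedness of \<open>lam\<close> on the compact timer interval.
\<close>

lemma exponential_decay:
  obtains C \<rho> where "0 < C" "0 \<le> \<rho>" "\<rho> < 1"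
    and "\<And>t x0 x zc zd k s. t \<in> range_dwell_time Tmin Tmax \<Longrightarrow>
      closed_loop_trajectory S Kc Kd t x0 (\<lambda>_. 0) (\<lambda>_. 0) x zc zd \<Longrightarrow>
      t k < s \<Longrightarrow> s \<le> t (Suc k) \<Longrightarrow> norm (x s) \<le> C * norm x0 * \<rho> ^ k"
proof -
  obtain B where B: "B > 0" "\<And>\<tau> i. \<tau> \<in> {0..Tmax} \<Longrightarrow> lam \<tau> $ i \<le> B"
    using lam_bounded by blast
  define m where "m = Min (range (\<lambda>i. lam 0 $ i))"
  have zero: "0 \<in> {0..Tmax}" using Tmin by auto
  have m: "m \<le> lam 0 $ i" for i unfolding m_def by simp
  have "m \<in> range (\<lambda>i. lam 0 $ i)" unfolding m_def by (rule Min_in) auto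
  with lam_pos[OF zero] have m0: "0 < m" by auto
  \<comment> \<open>This makes the contraction factor nonnegative: the jump maps \<open>lam Tmin\<close> to a nonnegative vector.\<close>
  have eps: "\<epsilon> \<le> lam 0 $ i" for i
  proof -
    have "0 \<le> (closed_jump S Kd Tmin *v lam Tmin + sysEd S *v 1) $ i"
      unfolding matrix_vector_mult_def vector_add_component vec_lambda_beta
      using Tmin jump_nonneg[of Tmin] Ed_nonneg lam_pos[of Tmin]
      by (intro add_nonneg_nonneg sum_nonneg mult_nonneg_nonneg) (auto simp: less_imp_le)
    with jump_le[of Tmin i] Tmin show ?thesis by simp
  qed
  define \<rho> where "\<rho> = 1 - \<epsilon> / B"
  have \<rho>: "0 \<le> \<rho>" "\<rho> < 1"
    using B(1) B(2)[OF zero] eps \<epsilon> by (auto simp: \<rho>_def field_simps intro: order_trans)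
  define C where "C = real CARD('n) * B / m"
  show thesis
  proof (rule that[of C \<rho>])
    show "0 < C" using B(1) m0 by (simp add: C_def)
    show "0 \<le> \<rho>" "\<rho> < 1" by (rule \<rho>)+
    fix t x0 x zc zd k s
    assume t: "t \<in> range_dwell_time Tmin Tmax"
      and traj: "closed_loop_trajectory S Kc Kd t x0 (\<lambda>_. 0) (\<lambda>_. 0) x zc zd"
      and s: "t k < s" "s \<le> t (Suc k)"
    have sT: "s - t k \<in> {0..Tmax}"
      using s t by (auto simp: range_dwell_time_def) (smt (verit, best))
    \<comment> \<open>Dividing by the least entry of \<open>lam 0\<close> makes the first box contain the initial state.\<close>
    define c where "c = (\<lambda>k. norm x0 / m * \<rho> ^ k)"
    have c0: "0 \<le> c k" for k using m0 \<rho> by (simp add: c_def)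
    have "\<bar>x s $ i\<bar> \<le> c k * lam (s - t k) $ i" for i
    proof (rule trajectory_envelope[OF t traj _ negligible_empty _ _ c0 _ s])
      show "\<bar>x0 $ i\<bar> \<le> c 0 * lam 0 $ i" for i
      proof -
        have "\<bar>x0 $ i\<bar> * m \<le> norm x0 * lam 0 $ i"
          by (intro mult_mono component_le_norm_cart m) (use m0 in auto)
        then show ?thesis using m0 by (simp add: c_def field_simps)
      qed
      show "c j * (lam 0 $ i - \<epsilon>) \<le> c (Suc j) * lam 0 $ i" for j i
      proof -
        have "\<epsilon> / B * lam 0 $ i \<le> \<epsilon> / B * B"
          using B(1) B(2)[OF zero] \<epsilon> by (intro mult_left_mono) auto
        then have "lam 0 $ i - \<epsilon> \<le> \<rho> * lam 0 $ i" using B(1) by (simp add: \<rho>_def algebra_simps)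
        from mult_left_mono[OF this c0[of j]] show ?thesis by (simp add: c_def algebra_simps)
      qed
    qed (use c0 in auto)
    also have "c k * lam (s - t k) $ i \<le> c k * B" for i
      by (intro mult_left_mono B(2) sT c0)
    finally have "(\<Sum>i\<in>UNIV. \<bar>x s $ i\<bar>) \<le> (\<Sum>i\<in>(UNIV::'n set). c k * B)"
      by (intro sum_mono)
    with norm_le_l1_cart[of "x s"] have "norm (x s) \<le> real CARD('n) * (c k * B)" by simp
    also have "\<dots> = C * norm x0 * \<rho> ^ k" by (simp add: C_def c_def)
    finally show "norm (x s) \<le> C * norm x0 * \<rho> ^ k" .
  qed
qed

lemma asymptotic_stability:
  assumes t: "t \<in> range_dwell_time Tmin Tmax"
  shows "asymptotically_stable S Kc Kd t"
proof -
  obtain C \<rho> where C: "0 < C" and \<rho>: "0 \<le> \<rho>" "\<rho> < 1"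
    and decay: "\<And>x0 x zc zd k s. closed_loop_trajectory S Kc Kd t x0 (\<lambda>_. 0) (\<lambda>_. 0) x zc zd \<Longrightarrow>
      t k < s \<Longrightarrow> s \<le> t (Suc k) \<Longrightarrow> norm (x s) \<le> C * norm x0 * \<rho> ^ k"
    using exponential_decay t by metis
  show ?thesis
    unfolding asymptotically_stable_def
  proof (intro conjI allI impI)
    fix e :: real assume e: "e > 0"
    show "\<exists>d>0. \<forall>x0 x zc zd. norm x0 < d \<and> closed_loop_trajectory S Kc Kd t x0 (\<lambda>_. 0) (\<lambda>_. 0) x zc zd \<longrightarrow>
        (\<forall>s\<ge>0. norm (x s) < e)"
    \<comment> \<open>The decay estimate covers positive times only; the bound by \<open>e\<close> itself takes care of time zero.\<close>
    proof (intro exI[of _ "min e (e / C)"] conjI allI impI)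
      show "0 < min e (e / C)" using e C by simp
      fix x0 x zc zd and s :: real
      assume *: "norm x0 < min e (e / C) \<and> closed_loop_trajectory S Kc Kd t x0 (\<lambda>_. 0) (\<lambda>_. 0) x zc zd"
        and "0 \<le> s"
      then have traj: "closed_loop_trajectory S Kc Kd t x0 (\<lambda>_. 0) (\<lambda>_. 0) x zc zd" by simp
      show "norm (x s) < e"
      proof (cases "s = 0")
        case True
        then show ?thesis using * closed_loop_initial(1)[OF traj] by simp
      next
        case False
        with \<open>0 \<le> s\<close> obtain k where "t k < s" "s \<le> t (Suc k)"
          using dwell_time_interval_exists[OF t Tmin(1), of s] by auto
        then have "norm (x s) \<le> C * norm x0 * \<rho> ^ k" by (rule decay[OF traj])
        also have "\<dots> \<le> C * norm x0 * 1"
          using \<rho> C by (intro mult_left_mono power_le_one) auto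
        also have "\<dots> < e" using * C by (simp add: field_simps)
        finally show ?thesis .
      qed
    qed
  next
    fix x0 x zc zd
    assume traj: "closed_loop_trajectory S Kc Kd t x0 (\<lambda>_. 0) (\<lambda>_. 0) x zc zd"
    show "(x \<longlongrightarrow> 0) at_top"
    proof (rule tendstoI)
      fix e :: real assume e: "e > 0"
      have "(\<lambda>k. C * norm x0 * \<rho> ^ k) \<longlonglongrightarrow> C * norm x0 * 0"
        using \<rho> by (intro tendsto_intros LIMSEQ_power_zero) auto
      then have "\<forall>\<^sub>F k in sequentially. C * norm x0 * \<rho> ^ k < e"
        using e by (intro order_tendstoD) auto
      then obtain n where n: "\<And>k. k \<ge> n \<Longrightarrow> C * norm x0 * \<rho> ^ k < e"
        unfolding eventually_sequentially by blast
      show "\<forall>\<^sub>F s in at_top. dist (x s) 0 < e"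
        using eventually_gt_at_top[of "max 0 (real n * Tmax)"]
      proof eventually_elim
        fix s assume s: "max 0 (real n * Tmax) < s"
        then obtain k where k: "t k < s" "s \<le> t (Suc k)"
          using dwell_time_interval_exists[OF t Tmin(1), of s] by auto
        have "real n * Tmax < real (Suc k) * Tmax"
          using s k(2) dwell_time_bounds(2)[OF t, of "Suc k"] by linarith
        then have "n \<le> k" using Tmin by simp
        with n[of k] decay[OF traj k] show "dist (x s) 0 < e" by simp
      qed
    qed
  qed
qed

end

section \<open>Essential suprema of vector signals\<close>

lemma infnorm_le_iff_cart: "infnorm v \<le> b \<longleftrightarrow> (\<forall>i. \<bar>v $ i\<bar> \<le> b)" for v :: "real^'m"
proof
  show "\<forall>i. \<bar>v $ i\<bar> \<le> b" if "infnorm v \<le> b"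
    using that component_le_infnorm_cart order_trans by blast
  show "infnorm v \<le> b" if "\<forall>i. \<bar>v $ i\<bar> \<le> b"
    unfolding infnorm_cart by (rule cSup_least) (use that in auto)
qed

lemma borel_measurable_vec_iff:
  fixes f :: "'a \<Rightarrow> real^'m"
  shows "f \<in> borel_measurable M \<longleftrightarrow> (\<forall>i. (\<lambda>x. f x $ i) \<in> borel_measurable M)"
  unfolding borel_measurable_euclidean_space[of f]
  by (auto simp: Basis_vec_def inner_axis)

lemma borel_measurable_matrix_vector_mult:
  fixes P :: "'a \<Rightarrow> real^'n^'m"
  assumes "P \<in> borel_measurable M" "v \<in> borel_measurable M"
  shows "(\<lambda>s. P s *v v s) \<in> borel_measurable M"
proof -
  have "(\<lambda>s. P s $ i $ j) \<in> borel_measurable M" for i j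
    by (intro borel_measurable_continuous_on[OF _ assms(1), of "\<lambda>A. A $ i $ j"] continuous_intros)
  moreover have "(\<lambda>s. v s $ j) \<in> borel_measurable M" for j
    using assms(2) by (simp add: borel_measurable_vec_iff)
  ultimately show ?thesis
    by (subst borel_measurable_vec_iff)
      (auto simp: matrix_vector_mult_def intro!: borel_measurable_sum borel_measurable_times)
qed

lemma Linf_norm_leD:
  assumes le: "Linf_norm w \<le> ereal b"
  obtains N where "negligible N" "\<And>s i. s \<in> {0..} - N \<Longrightarrow> \<bar>w s $ i\<bar> \<le> b"
proof -
  have "AE s in lebesgue_on {0..}. ereal (infnorm (w s)) \<le> Linf_norm w"
    unfolding Linf_norm_def by (rule esssup_AE)
  then have "AE s in lebesgue_on {0..}. infnorm (w s) \<le> b"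
  proof eventually_elim
    fix s assume "ereal (infnorm (w s)) \<le> Linf_norm w"
    then have "ereal (infnorm (w s)) \<le> ereal b" using le by (rule order_trans)
    then show "infnorm (w s) \<le> b" by simp
  qed
  then have "AE s in lebesgue. s \<in> {0..} \<longrightarrow> infnorm (w s) \<le> b"
    by (subst (asm) AE_restrict_space_iff) auto
  then obtain N where "{s \<in> space lebesgue. \<not> (s \<in> {0..} \<longrightarrow> infnorm (w s) \<le> b)} \<subseteq> N"
    "N \<in> null_sets lebesgue"
    unfolding eventually_ae_filter by blast
  then show thesis
    by (intro that[of N]) (auto simp: negligible_iff_null_sets infnorm_le_iff_cart)
qed

lemma Linf_norm_leI:
  assumes meas: "z \<in> borel_measurable (lebesgue_on {0..})" and N: "negligible N"
    and le: "\<And>s i. s \<in> {0..} - N \<Longrightarrow> \<bar>z s $ i\<bar> \<le> b"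
  shows "Linf_norm z \<le> ereal b"
  unfolding Linf_norm_def
proof (rule esssup_I)
  show "(\<lambda>s. ereal (infnorm (z s))) \<in> borel_measurable (lebesgue_on {0..})"
    by (intro borel_measurable_ereal borel_measurable_continuous_on[OF _ meas] continuous_intros)
  have "AE s in lebesgue. s \<notin> N"
    using N by (intro AE_not_in) (simp add: negligible_iff_null_sets)
  then have "AE s in lebesgue. s \<in> {0..} \<longrightarrow> ereal (infnorm (z s)) \<le> ereal b"
    by eventually_elim (use le in \<open>auto simp: infnorm_le_iff_cart\<close>)
  then show "AE s in lebesgue_on {0..}. ereal (infnorm (z s)) \<le> ereal b"
    by (subst AE_restrict_space_iff) auto
qed

section \<open>The hybrid gain\<close>

locale gain_certificate = stability_certificate S Kc Kd lam lam' Tmin Tmax \<epsilon>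
  for S :: "('n::finite, 'mc::finite, 'md::finite, 'pc::finite, 'pd::finite, 'qc::finite, 'qd::finite)
                impulsive_system"
    and Kc Kd lam lam' Tmin Tmax \<epsilon> +
  fixes \<gamma> :: real
  assumes continuous_flow_output: "continuous_on {0..Tmax} (closed_flow_output S Kc)"
    and continuous_Fc: "continuous_on {0..Tmax} (sysFc S)"
    and flow_output_nonneg: "\<And>\<tau> i j. \<tau> \<in> {0..Tmax} \<Longrightarrow> 0 \<le> closed_flow_output S Kc \<tau> $ i $ j"
    and Fc_nonneg: "\<And>\<tau> i j. \<tau> \<in> {0..Tmax} \<Longrightarrow> 0 \<le> sysFc S \<tau> $ i $ j"
    and jump_output_nonneg: "\<And>\<theta> i j. \<theta> \<in> {Tmin..Tmax} \<Longrightarrow> 0 \<le> closed_jump_output S Kd \<theta> $ i $ j"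
    and Fd_nonneg: "\<And>i j. 0 \<le> sysFd S $ i $ j"
    and flow_output_le: "\<And>\<tau> i. \<tau> \<in> {0..Tmax} \<Longrightarrow>
      (closed_flow_output S Kc \<tau> *v lam \<tau> + sysFc S \<tau> *v 1) $ i \<le> \<gamma>"
    and jump_output_le: "\<And>\<theta> i. \<theta> \<in> {Tmin..Tmax} \<Longrightarrow>
      (closed_jump_output S Kd \<theta> *v lam \<theta> + sysFd S *v 1) $ i \<le> \<gamma>"
begin

text \<open>
  The essential supremum of a non-measurable function is \<open>\<infinity>\<close> by definition, so the gain bound needs
  measurability of the output. On each flow interval it is a continuous function plus a continuous
  matrix applied to the measurable input, and countably many such intervals and the point 0 cover
  the time axis.
\<close>

lemma flow_output_measurable:
  assumes t: "t \<in> range_dwell_time Tmin Tmax"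
    and traj: "closed_loop_trajectory S Kc Kd t x0 wc wd x zc zd"
    and wc: "wc \<in> borel_measurable (lebesgue_on {0..})"
  shows "zc \<in> borel_measurable (lebesgue_on {0..})"
proof (rule measurable_piecewise_restrict)
  let ?C = "insert {0} (range (\<lambda>k. {t k<..t (Suc k)}))"
  show "countable ?C" by simp
  show "space (lebesgue_on {0..}) \<subseteq> \<Union>?C"
  proof
    fix s assume "s \<in> space (lebesgue_on {0::real..})"
    then have "0 \<le> s" by simp
    show "s \<in> \<Union>?C"
    proof (cases "s = 0")
      case False
      with \<open>0 \<le> s\<close> obtain k where "t k < s" "s \<le> t (Suc k)"
        using dwell_time_interval_exists[OF t Tmin(1), of s] by auto
      then have "s \<in> {t k<..t (Suc k)}" by simp
      then show ?thesis by blast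
    qed simp
  qed
  show "\<Omega> \<inter> space (lebesgue_on {0..}) \<in> sets (lebesgue_on {0..})" if "\<Omega> \<in> ?C" for \<Omega>
  proof -
    have "\<Omega> \<in> sets lebesgue" using that by auto
    then show ?thesis by (simp add: sets_restrict_space_iff sets.Int)
  qed
  have pos: "0 \<le> t k" for k
    by (rule order_trans[OF _ dwell_time_bounds(1)[OF t]]) (use Tmin in simp)
  have T: "t (Suc k) - t k \<le> Tmax" for k using t by (auto simp: range_dwell_time_def)
  fix \<Omega> assume "\<Omega> \<in> ?C"
  then consider "\<Omega> = {0}" | k where "\<Omega> = {t k<..t (Suc k)}" by blast
  then show "zc \<in> borel_measurable (restrict_space (lebesgue_on {0..}) \<Omega>)"
  proof cases
    case 1
    have "restrict_space (lebesgue_on {0..}) {0::real} = lebesgue_on {0}"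
      by (subst restrict_restrict_space) auto
    with 1 show ?thesis by (simp add: continuous_imp_measurable_on_sets_lebesgue)
  next
    case (2 k)
    let ?I = "{t k<..t (Suc k)}"
    have I: "{0..} \<inter> ?I = ?I" using pos[of k] by auto
    have restrict: "restrict_space (lebesgue_on {0..}) ?I = lebesgue_on ?I"
      by (subst restrict_restrict_space) (auto simp: I)
    have shift: "continuous_on ?I (\<lambda>s. P (s - t k))"
      if "continuous_on {0..Tmax} P" for P :: "real \<Rightarrow> 'a::topological_space"
      by (rule continuous_on_compose2[OF that]) (use T[of k] in \<open>auto intro!: continuous_intros\<close>)
    obtain xp where "(x \<longlongrightarrow> xp) (at_right (t k))"
    proof (cases k)
      case 0
      then have "t k = 0" using t by (simp add: range_dwell_time_def)
      with closed_loop_initial(2)[OF traj] show thesis by (intro that[of x0]) simp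
    next
      case (Suc j)
      with closed_loop_jump[OF traj, of j] that show thesis by blast
    qed
    from continuous_on_flow_with_right_limit[OF this closed_loop_flow[OF traj]]
    have "continuous_on {0..t (Suc k) - t k} (\<lambda>s. if s = 0 then xp else x (t k + s))" .
    then have "continuous_on ?I (\<lambda>s. if s - t k = 0 then xp else x (t k + (s - t k)))"
      by (rule continuous_on_compose2) (auto intro!: continuous_intros)
    then have x: "continuous_on ?I x"
      by (rule continuous_on_eq) auto
    have "(\<lambda>s. closed_flow_output S Kc (s - t k) *v x s + sysFc S (s - t k) *v wc s)
        \<in> borel_measurable (lebesgue_on ?I)"
    proof (intro borel_measurable_add borel_measurable_matrix_vector_mult)
      show "wc \<in> borel_measurable (lebesgue_on ?I)"
        using measurable_restrict_space1[OF wc, of ?I] by (simp add: restrict)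
    qed (auto intro!: continuous_imp_measurable_on_sets_lebesgue shift x
        continuous_flow_output continuous_Fc)
    moreover have "zc \<in> borel_measurable (lebesgue_on ?I) \<longleftrightarrow>
        (\<lambda>s. closed_flow_output S Kc (s - t k) *v x s + sysFc S (s - t k) *v wc s)
        \<in> borel_measurable (lebesgue_on ?I)"
    proof (rule measurable_cong)
      fix s assume "s \<in> space (lebesgue_on ?I)"
      then show "zc s = closed_flow_output S Kc (s - t k) *v x s + sysFc S (s - t k) *v wc s"
        using closed_loop_flow_output[OF traj, of "s - t k" k] by simp
    qed
    ultimately show ?thesis
      unfolding 2 restrict by simp
  qed
qed

text \<open>
  With zero initial state and inputs bounded by 1, the envelope with the constant sequence \<open>c = 1\<close>
  gives \<open>\<bar>x\<bar> \<le> lam\<close> at all positive times, and the output conditions state that \<open>\<gamma>\<close> bounds the outputs on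
  the corner \<open>x = lam\<close>, \<open>w = 1\<close> of the box.
\<close>

lemma hybrid_gain_le: "hybrid_gain S Kc Kd Tmin Tmax \<le> ereal \<gamma>"
  unfolding hybrid_gain_def
proof (rule Sup_least, clarify)
  fix zc zd t wc wd x
  assume t: "t \<in> range_dwell_time Tmin Tmax"
    and wc_meas: "wc \<in> borel_measurable (lebesgue_on {0..})"
    and w: "max (Linf_norm wc) (linf_norm wd) = 1"
    and traj: "closed_loop_trajectory S Kc Kd t 0 wc wd x zc zd"
  have T: "t (Suc k) - t k \<in> {Tmin..Tmax}" for k
    using t by (auto simp: range_dwell_time_def)
  have T': "t (Suc k) - t k \<in> {0..Tmax}" for k using T[of k] Tmin by auto
  have pos: "0 \<le> t k" for k
    by (rule order_trans[OF _ dwell_time_bounds(1)[OF t]]) (use Tmin in simp)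
  have "Linf_norm wc \<le> ereal 1" using w max.cobounded1[of "Linf_norm wc" "linf_norm wd"] by (simp add: one_ereal_def)
  then obtain N where N: "negligible N" and wc: "\<And>s j. s \<in> {0..} - N \<Longrightarrow> \<bar>wc s $ j\<bar> \<le> 1"
    using Linf_norm_leD by blast
  have wd: "\<bar>wd (Suc k) $ j\<bar> \<le> 1" for k j
  proof -
    have "ereal (infnorm (wd (Suc k))) \<le> linf_norm wd"
      unfolding linf_norm_def by (rule SUP_upper) simp
    also have "\<dots> \<le> ereal 1" using w max.cobounded2[of "linf_norm wd" "Linf_norm wc"] by (simp add: one_ereal_def)
    finally show ?thesis by (simp add: infnorm_le_iff_cart)
  qed
  have x: "\<bar>x s $ i\<bar> \<le> 1 * lam (s - t k) $ i" if "t k < s" "s \<le> t (Suc k)" for k s i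
  proof (rule trajectory_envelope[OF t traj _ N, where c = "\<lambda>_. 1"])
    show "\<bar>wc s $ j\<bar> \<le> 1" if "s \<in> {t k<..t (Suc k)} - N" for k s j
      using that pos[of k] by (intro wc) auto
  qed (use wd that \<epsilon> Tmin lam_pos[of 0] in \<open>auto simp: less_imp_le\<close>)
  have "Linf_norm zc \<le> ereal \<gamma>"
  proof (rule Linf_norm_leI[OF flow_output_measurable[OF t traj wc_meas]])
    \<comment> \<open>The trajectory leaves the output at time zero unspecified.\<close>
    show "negligible (insert 0 N)" using N by simp
    fix s :: real and i assume s: "s \<in> {0..} - insert 0 N"
    then obtain k where k: "t k < s" "s \<le> t (Suc k)"
      using dwell_time_interval_exists[OF t Tmin(1), of s] by auto
    then have \<tau>: "s - t k \<in> {0..Tmax}" using T'[of k] by auto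
    have "\<bar>zc s $ i\<bar> = \<bar>(closed_flow_output S Kc (s - t k) *v x s + sysFc S (s - t k) *v wc s) $ i\<bar>"
      using closed_loop_flow_output[OF traj, of "s - t k" k] k by simp
    also have "\<dots> \<le> 1 * (closed_flow_output S Kc (s - t k) *v lam (s - t k) + sysFc S (s - t k) *v 1) $ i"
      by (rule abs_nonneg_combination_le[OF flow_output_nonneg[OF \<tau>] Fc_nonneg[OF \<tau>] x[OF k] wc])
        (use s in auto)
    also have "\<dots> \<le> \<gamma>" using flow_output_le[OF \<tau>] by simp
    finally show "\<bar>zc s $ i\<bar> \<le> \<gamma>" .
  qed
  moreover have "linf_norm zd \<le> ereal \<gamma>"
    unfolding linf_norm_def
  proof (rule SUP_least)
    fix n :: nat assume "n \<in> {1..}"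
    then obtain k where n: "n = Suc k" by (cases n) auto
    let ?T = "t (Suc k) - t k"
    have x': "\<bar>x (t (Suc k)) $ j\<bar> \<le> 1 * lam ?T $ j" for j
      using x[of k "t (Suc k)" j] T[of k] Tmin by auto
    have "\<bar>zd n $ i\<bar> \<le> \<gamma>" for i
    proof -
      have "\<bar>zd n $ i\<bar> = \<bar>(closed_jump_output S Kd ?T *v x (t (Suc k)) + sysFd S *v wd (Suc k)) $ i\<bar>"
        unfolding n closed_loop_jump_output[OF traj] ..
      also have "\<dots> \<le> 1 * (closed_jump_output S Kd ?T *v lam ?T + sysFd S *v 1) $ i"
        by (rule abs_nonneg_combination_le[OF jump_output_nonneg[OF T] Fd_nonneg x' wd])
      also have "\<dots> \<le> \<gamma>" using jump_output_le[OF T] by simp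
      finally show ?thesis .
    qed
    then show "ereal (infnorm (zd n)) \<le> ereal \<gamma>" by (simp add: infnorm_le_iff_cart)
  qed
  ultimately show "max (Linf_norm zc) (linf_norm zd) \<le> ereal \<gamma>" by simp
qed

end

section \<open>Diagonal scalings and the synthesis theorem\<close>

lemma diagonal_mult_entry:
  fixes P :: "real^'n^'m"
  assumes "diagonal_matrix D"
  shows "(P ** D) $ i $ j = P $ i $ j * D $ j $ j"
proof -
  have "(P ** D) $ i $ j = (\<Sum>k\<in>UNIV. P $ i $ k * D $ k $ j)" by (simp add: matrix_matrix_mult_def)
  also have "\<dots> = (\<Sum>k\<in>UNIV. if k = j then P $ i $ j * D $ j $ j else 0)"
    using assms by (intro sum.cong) (auto simp: diagonal_matrix_def)
  finally show ?thesis by simp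
qed

lemma diagonal_mult_one_entry:
  assumes "diagonal_matrix (D :: real^'n^'n)"
  shows "(D *v 1) $ j = D $ j $ j"
proof -
  have "(D *v 1) $ j = (\<Sum>k\<in>UNIV. if k = j then D $ j $ j else 0)"
    unfolding matrix_vector_mult_def vec_lambda_beta
    using assms by (intro sum.cong) (auto simp: diagonal_matrix_def)
  then show ?thesis by simp
qed

lemma matrix_inv_mult_self:
  assumes "invertible (D :: real^'n^'n)"
  shows "matrix_inv D ** D = mat 1"
  using someI_ex[OF assms[unfolded invertible_def]] by (simp add: matrix_inv_def)

text \<open>
  The linearising change of variables \<open>K = U X\<^sup>-\<^sup>1\<close>: multiplied by \<open>X\<close>, each closed-loop matrix becomes
  an expression that is linear in \<open>X\<close> and \<open>U\<close>.
\<close>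

lemma inverse_gain_mult:
  fixes U :: "real^'n^'m" and D :: "real^'n^'n"
  assumes "invertible D"
  shows "(P + R ** (U ** matrix_inv D)) ** D = P ** D + R ** U"
proof -
  have "(R ** (U ** matrix_inv D)) ** D = R ** (U ** (matrix_inv D ** D))"
    by (simp only: matrix_mul_assoc)
  moreover have "(P + Q) ** D = P ** D + Q ** D" for Q
    by (simp add: vec_eq_iff matrix_matrix_mult_def sum.distrib distrib_right)
  ultimately show ?thesis
    by (simp add: matrix_inv_mult_self[OF assms])
qed

lemma matrix_inv_diagonal_entry:
  fixes D :: "real^'n^'n"
  assumes "diagonal_matrix D" "invertible D"
  shows "D $ j $ j \<noteq> 0" and "matrix_inv D $ i $ j = (if i = j then 1 / D $ j $ j else 0)"
proof -
  have eq: "matrix_inv D $ i $ j * D $ j $ j = (if i = j then 1 else 0)" for i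
    using matrix_inv_mult_self[OF assms(2)] diagonal_mult_entry[OF assms(1), of "matrix_inv D" i j]
    by (simp add: mat_def)
  from eq[of j] show nz: "D $ j $ j \<noteq> 0" by auto
  with eq[of i] show "matrix_inv D $ i $ j = (if i = j then 1 / D $ j $ j else 0)"
    by (auto simp: field_simps)
qed

lemma continuous_on_matrix_mult:
  fixes P :: "'a::topological_space \<Rightarrow> real^'n^'m" and Q :: "'a \<Rightarrow> real^'k^'n"
  assumes "continuous_on A P" "continuous_on A Q"
  shows "continuous_on A (\<lambda>s. P s ** Q s)"
  unfolding matrix_matrix_mult_def by (intro continuous_intros assms)

lemma continuous_on_diagonal_matrix_inv:
  fixes D :: "'a::topological_space \<Rightarrow> real^'n^'n"
  assumes "continuous_on A D" "\<And>s. s \<in> A \<Longrightarrow> diagonal_matrix (D s)" "\<And>s. s \<in> A \<Longrightarrow> invertible (D s)"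
  shows "continuous_on A (\<lambda>s. matrix_inv (D s))"
proof -
  have "continuous_on A (\<lambda>s. \<chi> i j. if i = j then 1 / D s $ j $ j else 0)"
  proof (intro continuous_on_vec_lambda)
    fix i j
    show "continuous_on A (\<lambda>s. if i = j then 1 / D s $ j $ j else 0)"
      using assms matrix_inv_diagonal_entry(1)
      by (cases "i = j") (auto intro!: continuous_intros)
  qed
  then show ?thesis
    by (rule continuous_on_eq) (simp add: vec_eq_iff matrix_inv_diagonal_entry(2)[OF assms(2,3)])
qed

lemma positive_definite_diagonal_entry_pos:
  assumes "positive_definite (D :: real^'n^'n)"
  shows "0 < D $ j $ j"
proof -
  have "0 < axis j 1 \<bullet> (D *v axis j 1)"
    using assms unfolding positive_definite_def by (auto simp: axis_eq_0_iff)
  then show ?thesis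
    by (simp add: matrix_vector_mult_basis column_def inner_axis')
qed

text \<open>
  A diagonal entry cannot change sign without vanishing, which invertibility forbids.
\<close>

lemma diagonal_entries_stay_positive:
  fixes D :: "real \<Rightarrow> real^'n^'n"
  assumes cont: "continuous_on {a..b} D" and "\<And>s. s \<in> {a..b} \<Longrightarrow> diagonal_matrix (D s)"
    and "\<And>s. s \<in> {a..b} \<Longrightarrow> invertible (D s)" and start: "positive_definite (D a)"
    and s: "s \<in> {a..b}"
  shows "0 < D s $ j $ j"
proof (rule ccontr)
  assume "\<not> 0 < D s $ j $ j"
  moreover have "continuous_on {a..s} (\<lambda>r. D r $ j $ j)"
    using s by (intro continuous_intros continuous_on_subset[OF cont]) auto
  ultimately obtain r where "a \<le> r" "r \<le> s" "D r $ j $ j = 0"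
    using IVT2'[of "\<lambda>r. D r $ j $ j" s 0 a] positive_definite_diagonal_entry_pos[OF start, of j] s
    by auto
  with matrix_inv_diagonal_entry(1)[OF assms(2,3), of r j] s show False by auto
qed

lemma has_vector_derivative_mult_vector:
  fixes D :: "real \<Rightarrow> real^'n^'m"
  assumes "(D has_vector_derivative D') F"
  shows "((\<lambda>s. D s *v v) has_vector_derivative D' *v v) F"
proof (rule bounded_linear.has_vector_derivative[OF _ assms])
  show "bounded_linear (\<lambda>P :: real^'n^'m. P *v v)"
    unfolding linear_conv_bounded_linear[symmetric]
    by (rule linearI) (simp_all add: matrix_vector_mult_add_rdistrib scaleR_matrix_vector_assoc)
qed

lemma nonneg_matrix_iff: "0 \<le> P \<longleftrightarrow> (\<forall>i j. 0 \<le> P $ i $ j)" for P :: "real^'n^'m"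
  by (simp add: less_eq_vec_def)

theorem theorem4p3:
  fixes S :: "('n::finite, 'mc::finite, 'md::finite, 'pc::finite, 'pd::finite, 'qc::finite, 'qd::finite)
                impulsive_system"
    and X X' :: "real \<Rightarrow> real^'n^'n"
    and Uc :: "real \<Rightarrow> real^'n^'mc"
    and Ud :: "real \<Rightarrow> real^'n^'md"
    and Tmin Tmax \<epsilon> \<alpha> \<gamma> :: real
  assumes "0 < Tmin" and "Tmin \<le> Tmax"
    and "continuous_on {0..Tmax} (sysA S)" and "continuous_on {0..Tmax} (sysBc S)"
    and "continuous_on {0..Tmax} (sysEc S)" and "continuous_on {0..Tmax} (sysCc S)"
    and "continuous_on {0..Tmax} (sysDc S)" and "continuous_on {0..Tmax} (sysFc S)"
    and "continuous_on {0..Tmax} Uc"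
    and "\<And>\<tau>. \<tau> \<in> {0..Tmax} \<Longrightarrow> 0 \<le> sysEc S \<tau>" and "\<And>\<tau>. \<tau> \<in> {0..Tmax} \<Longrightarrow> 0 \<le> sysFc S \<tau>"
    and "0 \<le> sysEd S" and "0 \<le> sysFd S"
    and "\<And>\<tau>. \<tau> \<in> {0..Tmax} \<Longrightarrow> (X has_vector_derivative X' \<tau>) (at \<tau> within {0..Tmax})"
    and "\<And>\<tau>. \<tau> \<in> {0..Tmax} \<Longrightarrow> diagonal_matrix (X \<tau>)"
    and "\<And>\<tau>. \<tau> \<in> {0..Tmax} \<Longrightarrow> invertible (X \<tau>)"
    and "positive_definite (X 0)"
    and "\<epsilon> > 0" and "\<alpha> > 0" and "\<gamma> > 0"
    and "\<And>\<tau>. \<tau> \<in> {0..Tmax} \<Longrightarrow> 0 \<le> sysA S \<tau> ** X \<tau> + sysBc S \<tau> ** Uc \<tau> + \<alpha> *\<^sub>R mat 1"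
    and "\<And>\<theta>. \<theta> \<in> {Tmin..Tmax} \<Longrightarrow> 0 \<le> sysJ S ** X \<theta> + sysBd S ** Ud \<theta>"
    and "\<And>\<tau>. \<tau> \<in> {0..Tmax} \<Longrightarrow> 0 \<le> sysCc S \<tau> ** X \<tau> + sysDc S \<tau> ** Uc \<tau>"
    and "\<And>\<theta>. \<theta> \<in> {Tmin..Tmax} \<Longrightarrow> 0 \<le> sysCd S ** X \<theta> + sysDd S ** Ud \<theta>"
    and "\<And>\<tau>. \<tau> \<in> {0..Tmax} \<Longrightarrow>
           (- X' \<tau> + sysA S \<tau> ** X \<tau> + sysBc S \<tau> ** Uc \<tau>) *v 1 + sysEc S \<tau> *v 1 \<le> 0"
    and "\<And>\<theta>. \<theta> \<in> {Tmin..Tmax} \<Longrightarrow>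
           (sysJ S ** X \<theta> + sysBd S ** Ud \<theta> - X 0 + \<epsilon> *\<^sub>R mat 1) *v 1 + sysEd S *v 1 \<le> 0"
    and "\<And>\<tau>. \<tau> \<in> {0..Tmax} \<Longrightarrow>
           (sysCc S \<tau> ** X \<tau> + sysDc S \<tau> ** Uc \<tau>) *v 1 + sysFc S \<tau> *v 1 - \<gamma> *\<^sub>R 1 \<le> 0"
    and "\<And>\<theta>. \<theta> \<in> {Tmin..Tmax} \<Longrightarrow>
           (sysCd S ** X \<theta> + sysDd S ** Ud \<theta>) *v 1 + sysFd S *v 1 - \<gamma> *\<^sub>R 1 \<le> 0"
  shows "let Kc = (\<lambda>\<tau>. Uc \<tau> ** matrix_inv (X \<tau>)); Kd = (\<lambda>\<theta>. Ud \<theta> ** matrix_inv (X \<theta>)) in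
           (\<forall>t\<in>range_dwell_time Tmin Tmax. asymptotically_stable S Kc Kd t) \<and>
           hybrid_gain S Kc Kd Tmin Tmax \<le> ereal \<gamma>"
proof -
  note Tmin = assms(1,2)
  note contA = assms(3) and contBc = assms(4) and contCc = assms(6) and contDc = assms(7)
    and contFc = assms(8) and contUc = assms(9)
  note Ec = assms(10) and Fc = assms(11) and Ed = assms(12) and Fd = assms(13)
  note X_deriv = assms(14) and diag = assms(15) and inv = assms(16)
  note flow_metzler = assms(21) and jump_nonneg = assms(22) and flow_output_nonneg = assms(23)
    and jump_output_nonneg = assms(24)
  note flow_le = assms(25) and jump_le = assms(26) and flow_output_le = assms(27)
    and jump_output_le = assms(28)
  define Kc where "Kc = (\<lambda>\<tau>. Uc \<tau> ** matrix_inv (X \<tau>))"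
  define Kd where "Kd = (\<lambda>\<theta>. Ud \<theta> ** matrix_inv (X \<theta>))"
  define lam where "lam = (\<lambda>\<tau>. X \<tau> *v 1)"
  define lam' where "lam' = (\<lambda>\<tau>. X' \<tau> *v 1)"
  have range: "\<theta> \<in> {0..Tmax}" if "\<theta> \<in> {Tmin..Tmax}" for \<theta>
    using that Tmin by auto
  have contX: "continuous_on {0..Tmax} X"
    using X_deriv by (rule continuous_on_vector_derivative)
  have X_pos: "0 < X \<tau> $ j $ j" if "\<tau> \<in> {0..Tmax}" for \<tau> j
    by (rule diagonal_entries_stay_positive[OF contX diag inv assms(17) that])
  have contKc: "continuous_on {0..Tmax} Kc"
    unfolding Kc_def
    by (intro continuous_on_matrix_mult continuous_on_diagonal_matrix_inv contUc contX diag inv)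

  have flow_X: "closed_flow S Kc \<tau> ** X \<tau> = sysA S \<tau> ** X \<tau> + sysBc S \<tau> ** Uc \<tau>"
    and flow_output_X: "closed_flow_output S Kc \<tau> ** X \<tau> = sysCc S \<tau> ** X \<tau> + sysDc S \<tau> ** Uc \<tau>"
    if "\<tau> \<in> {0..Tmax}" for \<tau>
    unfolding closed_flow_def closed_flow_output_def Kc_def
    by (rule inverse_gain_mult[OF inv[OF that]])+
  have jump_X: "closed_jump S Kd \<theta> ** X \<theta> = sysJ S ** X \<theta> + sysBd S ** Ud \<theta>"
    and jump_output_X: "closed_jump_output S Kd \<theta> ** X \<theta> = sysCd S ** X \<theta> + sysDd S ** Ud \<theta>"
    if "\<theta> \<in> {Tmin..Tmax}" for \<theta>
    unfolding closed_jump_def closed_jump_output_def Kd_def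
    by (rule inverse_gain_mult[OF inv[OF range[OF that]]])+
  \<comment> \<open>Right multiplication by \<open>X\<close> scales the columns by positive numbers and so preserves signs.\<close>
  have entry_nonneg: "0 \<le> P $ i $ j" if "\<tau> \<in> {0..Tmax}" "0 \<le> (P ** X \<tau>) $ i $ j"
    for P :: "real^'n^'k" and \<tau> i j
    using that(2) X_pos[OF that(1), of j]
    by (simp add: diagonal_mult_entry[OF diag[OF that(1)]] zero_le_mult_iff)

  interpret gain_certificate S Kc Kd lam lam' Tmin Tmax \<epsilon> \<gamma>
  proof
    show "0 < Tmin" "Tmin \<le> Tmax" "0 < \<epsilon>" by (fact assms)+
    show "continuous_on {0..Tmax} (closed_flow S Kc)"
      unfolding closed_flow_def
      by (intro continuous_on_add continuous_on_matrix_mult contA contBc contKc)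
    show "continuous_on {0..Tmax} (closed_flow_output S Kc)"
      unfolding closed_flow_output_def
      by (intro continuous_on_add continuous_on_matrix_mult contCc contDc contKc)
    show "continuous_on {0..Tmax} (sysFc S)" by (rule contFc)
    show "0 \<le> sysEd S $ i $ j" for i j using Ed by (simp add: nonneg_matrix_iff)
    show "0 \<le> sysFd S $ i $ j" for i j using Fd by (simp add: nonneg_matrix_iff)
  next
    fix \<tau> i j assume \<tau>: "\<tau> \<in> {0..Tmax}"
    show "0 \<le> sysEc S \<tau> $ i $ j" for i j using Ec[OF \<tau>] by (simp add: nonneg_matrix_iff)
    show "0 \<le> sysFc S \<tau> $ i $ j" for i j using Fc[OF \<tau>] by (simp add: nonneg_matrix_iff)
    show "0 < lam \<tau> $ i" for i
      using X_pos[OF \<tau>] by (simp add: lam_def diagonal_mult_one_entry[OF diag[OF \<tau>]])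
    show "(lam has_vector_derivative lam' \<tau>) (at \<tau> within {0..Tmax})"
      unfolding lam_def lam'_def by (rule has_vector_derivative_mult_vector[OF X_deriv[OF \<tau>]])
    \<comment> \<open>The shift by \<open>\<alpha>\<close> affects the diagonal only.\<close>
    show "0 \<le> closed_flow S Kc \<tau> $ i $ j" if "i \<noteq> j" for i j
    proof (rule entry_nonneg[OF \<tau>])
      have "0 \<le> (sysA S \<tau> ** X \<tau> + sysBc S \<tau> ** Uc \<tau> + \<alpha> *\<^sub>R mat 1) $ i $ j"
        using flow_metzler[OF \<tau>] by (simp only: nonneg_matrix_iff)
      then show "0 \<le> (closed_flow S Kc \<tau> ** X \<tau>) $ i $ j"
        using that by (simp add: flow_X[OF \<tau>] mat_def)
    qed
    show "0 \<le> closed_flow_output S Kc \<tau> $ i $ j" for i j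
      using flow_output_nonneg[OF \<tau>]
      by - (rule entry_nonneg[OF \<tau>], simp only: nonneg_matrix_iff flow_output_X[OF \<tau>])
    show "(closed_flow S Kc \<tau> *v lam \<tau> + sysEc S \<tau> *v 1) $ i \<le> lam' \<tau> $ i" for i
    proof -
      have "((- X' \<tau> + sysA S \<tau> ** X \<tau> + sysBc S \<tau> ** Uc \<tau>) *v 1 + sysEc S \<tau> *v 1) $ i \<le> 0"
        using flow_le[OF \<tau>] by (simp add: less_eq_vec_def)
      moreover have "- X' \<tau> + sysA S \<tau> ** X \<tau> + sysBc S \<tau> ** Uc \<tau>
          = closed_flow S Kc \<tau> ** X \<tau> - X' \<tau>"
        unfolding flow_X[OF \<tau>] by simp
      ultimately have "((closed_flow S Kc \<tau> ** X \<tau> - X' \<tau>) *v 1 + sysEc S \<tau> *v 1) $ i \<le> 0"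
        by (simp only:)
      then show ?thesis
        unfolding lam_def lam'_def matrix_vector_mul_assoc matrix_vector_mult_diff_rdistrib
        by (simp only: vector_add_component vector_minus_component)
    qed
    show "(closed_flow_output S Kc \<tau> *v lam \<tau> + sysFc S \<tau> *v 1) $ i \<le> \<gamma>" for i
      using flow_output_le[OF \<tau>]
      unfolding lam_def matrix_vector_mul_assoc flow_output_X[OF \<tau>] by (simp add: less_eq_vec_def)
  next
    fix \<theta> assume \<theta>: "\<theta> \<in> {Tmin..Tmax}"
    show "0 \<le> closed_jump S Kd \<theta> $ i $ j" for i j
      using jump_nonneg[OF \<theta>]
      by - (rule entry_nonneg[OF range[OF \<theta>]], simp only: nonneg_matrix_iff jump_X[OF \<theta>])
    show "0 \<le> closed_jump_output S Kd \<theta> $ i $ j" for i j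
      using jump_output_nonneg[OF \<theta>]
      by - (rule entry_nonneg[OF range[OF \<theta>]], simp only: nonneg_matrix_iff jump_output_X[OF \<theta>])
    show "(closed_jump S Kd \<theta> *v lam \<theta> + sysEd S *v 1) $ i \<le> lam 0 $ i - \<epsilon>" for i
    proof -
      have "((sysJ S ** X \<theta> + sysBd S ** Ud \<theta> - X 0 + \<epsilon> *\<^sub>R mat 1) *v 1 + sysEd S *v 1) $ i \<le> 0"
        using jump_le[OF \<theta>] by (simp add: less_eq_vec_def)
      then have "((closed_jump S Kd \<theta> ** X \<theta>) *v 1 - X 0 *v 1 + \<epsilon> *\<^sub>R 1 + sysEd S *v 1) $ i \<le> 0"
        by (simp only: jump_X[OF \<theta>] matrix_vector_mult_add_rdistrib matrix_vector_mult_diff_rdistrib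
            scaleR_matrix_vector_assoc[symmetric] matrix_vector_mul_lid)
      then show ?thesis
        unfolding lam_def matrix_vector_mul_assoc by simp
    qed
    show "(closed_jump_output S Kd \<theta> *v lam \<theta> + sysFd S *v 1) $ i \<le> \<gamma>" for i
      using jump_output_le[OF \<theta>]
      unfolding lam_def matrix_vector_mul_assoc jump_output_X[OF \<theta>] by (simp add: less_eq_vec_def)
  qed
  show ?thesis
    using asymptotic_stability hybrid_gain_le by (simp add: Let_def Kc_def Kd_def)
qed

end
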